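(* Let $k\in\mathbb{N}=\{1,2,3,\dots\}$ and $M\in\mathbb{R}$, and let $\mathcal{H}_{k,M}$ be the family of all holomorphic functions $f$ on the unit disk $\mathbb{D}$ with $\Vert S_k(f)\Vert_\infty\le M$, where $S_k(f)$ is the generalized Schwarzian derivative of order $k$. Then: (i) the family $\{f''/f' : f\in\mathcal{H}_{k,M}\}$ is locally uniformly bounded on $\mathbb{D}$; (ii) the family $\{f'/f : f\in\mathcal{H}_{k,M}\}$ is normal on $\mathbb{D}$, and no sequence in this family converges to $\infty$ (locally uniformly on $\mathbb{D}$); (iii) the family $\{f' : f\in\mathcal{H}_{k,M}\}$ is normal on $\mathbb{D}$; (iv) the family $\mathcal{H}_{k,M}$ is quasi-normal on $\mathbb{D}$.
   Context: $\mathbb{D}=\{z\in\mathbb{C}:|z|<1\}$. Generalized Schwarzian derivative: for a non-constant meromorphic function $f$ on $\mathbb{D}$ and $n\in\mathbb{N}$, put $S_{2,n}(f):=f''/f'$ and, for $k\ge 2$, $S_{k+1,n}(f):=\big(S_{k,n}(f)\big)'-\frac1n\frac{f''}{f'}\,S_{k,n}(f)$ (as meromorphic functions on $\mathbb{D}$). For $k\in\mathbb{N}$ define $S_k(f):=S_{k+1,k}(f)$. (So $S_1(f)=f''/f'$ and $S_2(f)$ is the classical Schwarzian.) For constant functions $c$ one sets $S_k(c)\equiv\infty$; in particular no constant function belongs to $\mathcal{H}_{k,M}$. $\Vert\cdot\Vert_\infty$ is the supremum norm on $\mathbb{D}$; the condition $\Vert S_k(f)\Vert_\infty\le M$ entails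 that $S_k(f)$ has no poles in $\mathbb{D}$. A family $\mathcal{F}$ of meromorphic functions on a domain $D\subseteq\mathbb{C}$ is quasi-normal on $D$ if every sequence in $\mathcal{F}$ has a subsequence for which there is a set $E\subseteq D$ with no accumulation point in $D$ such that the subsequence converges locally uniformly on $D\setminus E$ with respect to the spherical metric (the limit $\equiv\infty$ is allowed). It is normal if one can always take $E=\emptyset$. *)

theory Defs
  imports "HOL-Complex_Analysis.Complex_Analysis"
begin

abbreviation unit_disk :: "complex set"  (\<open>\<bbbD>\<close>)
  where "\<bbbD> \<equiv> ball 0 1"

section \<open>Meromorphic functions as maps into the Riemann sphere\<close>

text \<open>
  The Riemann sphere is the unit sphere of the Euclidean space \<^typ>\<open>complex \<times> real\<close>, via
  stereographic projection from the north pole. Its spherical metric is the restriction of the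
  ambient \<^const>\<open>dist\<close>, i.e. the chordal metric (see \<open>dist_stereo\<close> and \<open>dist_stereo_infinity\<close>).
  A chord d and the arc 2 arcsin (d / 2) over it satisfy d \<le> arc \<le> (\<pi> / 2) d, so geodesic
  distance on the sphere yields the same uniform convergence.
\<close>

definition stereo :: "complex \<Rightarrow> complex \<times> real"
  where "stereo z = ((2 / (1 + (cmod z)\<^sup>2)) *\<^sub>R z, ((cmod z)\<^sup>2 - 1) / ((cmod z)\<^sup>2 + 1))"

definition sphere_infinity :: "complex \<times> real"
  where "sphere_infinity = (0, 1)"

lemma dist_stereo:
  "dist (stereo a) (stereo b) =
     2 * cmod (a - b) / (sqrt (1 + (cmod a)\<^sup>2) * sqrt (1 + (cmod b)\<^sup>2))"
proof -
  obtain x y where a: "a = Complex x y" by (cases a)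
  obtain u v where b: "b = Complex u v" by (cases b)
  define p where "p = 1 + x\<^sup>2 + y\<^sup>2"
  define q where "q = 1 + u\<^sup>2 + v\<^sup>2"
  have p: "p > 0" and q: "q > 0"
    unfolding p_def q_def by (auto intro!: add_pos_nonneg)
  have na: "(cmod a)\<^sup>2 = p - 1" and nb: "(cmod b)\<^sup>2 = q - 1"
    by (simp_all add: a b p_def q_def cmod_power2)
  have sa: "stereo a = (Complex (2 * x / p) (2 * y / p), (p - 2) / p)"
    unfolding stereo_def na by (simp add: a complex_eq_iff)
  have sb: "stereo b = (Complex (2 * u / q) (2 * v / q), (q - 2) / q)"
    unfolding stereo_def nb by (simp add: b complex_eq_iff)
  have "(dist (stereo a) (stereo b))\<^sup>2 =
      (2 * x / p - 2 * u / q)\<^sup>2 + (2 * y / p - 2 * v / q)\<^sup>2 + ((p - 2) / p - (q - 2) / q)\<^sup>2"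
    unfolding sa sb dist_prod_def by (simp add: dist_norm cmod_power2)
  also have "\<dots> = 4 * ((x * q - u * p)\<^sup>2 + (y * q - v * p)\<^sup>2 + (p - q)\<^sup>2) / (p\<^sup>2 * q\<^sup>2)"
  proof -
    have "2 * x / p - 2 * u / q = 2 * (x * q - u * p) / (p * q)"
      "2 * y / p - 2 * v / q = 2 * (y * q - v * p) / (p * q)"
      "(p - 2) / p - (q - 2) / q = 2 * (p - q) / (p * q)"
      using p q by (simp_all add: field_simps)
    thus ?thesis
      by (simp only: power_divide power_mult_distrib) (simp add: add_divide_distrib)
  qed
  also have "(x * q - u * p)\<^sup>2 + (y * q - v * p)\<^sup>2 + (p - q)\<^sup>2 = ((x - u)\<^sup>2 + (y - v)\<^sup>2) * (p * q)"
  proof -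
    have "(x * q - u * p)\<^sup>2 + (y * q - v * p)\<^sup>2 + (p - q)\<^sup>2 =
        (x\<^sup>2 + y\<^sup>2) * q\<^sup>2 + (u\<^sup>2 + v\<^sup>2) * p\<^sup>2 - 2 * (x * u + y * v) * (p * q) + (p - q)\<^sup>2"
      by (simp add: power2_eq_square algebra_simps)
    also have "x\<^sup>2 + y\<^sup>2 = p - 1" by (simp add: p_def)
    also have "u\<^sup>2 + v\<^sup>2 = q - 1" by (simp add: q_def)
    also have "(p - 1) * q\<^sup>2 + (q - 1) * p\<^sup>2 - 2 * (x * u + y * v) * (p * q) + (p - q)\<^sup>2 =
        ((p - 1) + (q - 1) - 2 * (x * u + y * v)) * (p * q)"
      by (simp add: power2_eq_square algebra_simps)
    also have "(p - 1) + (q - 1) - 2 * (x * u + y * v) = (x - u)\<^sup>2 + (y - v)\<^sup>2"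
      by (simp add: p_def q_def power2_eq_square algebra_simps)
    finally show ?thesis .
  qed
  also have "4 * (((x - u)\<^sup>2 + (y - v)\<^sup>2) * (p * q)) / (p\<^sup>2 * q\<^sup>2) =
      4 * ((x - u)\<^sup>2 + (y - v)\<^sup>2) / (p * q)"
    using p q by (simp add: divide_simps power2_eq_square)
  also have "\<dots> = (2 * cmod (a - b) / (sqrt p * sqrt q))\<^sup>2"
    using p q by (simp add: a b power_divide power_mult_distrib cmod_power2)
  finally have "dist (stereo a) (stereo b) = 2 * cmod (a - b) / (sqrt p * sqrt q)"
    by (rule power2_eq_imp_eq) (use p q in simp_all)
  thus ?thesis by (simp add: na nb)
qed

lemma dist_stereo_infinity:
  "dist (stereo a) sphere_infinity = 2 / sqrt (1 + (cmod a)\<^sup>2)"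
proof -
  define p where "p = 1 + (cmod a)\<^sup>2"
  have p1: "p \<ge> 1" by (simp add: p_def)
  hence p: "p > 0" by simp
  have na: "(cmod a)\<^sup>2 = p - 1" by (simp add: p_def)
  have sa: "stereo a = ((2 / p) *\<^sub>R a, (p - 2) / p)"
    unfolding stereo_def na by simp
  have "(dist (stereo a) sphere_infinity)\<^sup>2 = (2 / p)\<^sup>2 * (p - 1) + ((p - 2) / p - 1)\<^sup>2"
    unfolding sa sphere_infinity_def dist_prod_def
    using p1 by (simp add: dist_norm power2_commute power_mult_distrib power_divide na)
  also have "\<dots> = (2 / sqrt p)\<^sup>2"
    using p by (simp add: divide_simps power2_eq_square)
  finally have "dist (stereo a) sphere_infinity = 2 / sqrt p"
    by (rule power2_eq_imp_eq) (use p in simp_all)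
  thus ?thesis by (simp add: p_def)
qed

text \<open>
  A meromorphic function is represented by any \<open>f :: complex \<Rightarrow> complex\<close> with
  \<open>f meromorphic_on D\<close>; the values of \<open>f\<close> at its isolated singularities carry no meaning.
  In particular the pointwise quotient of two functions represents their meromorphic quotient.
\<close>

definition sphere_val :: "(complex \<Rightarrow> complex) \<Rightarrow> complex \<Rightarrow> complex \<times> real"
  where "sphere_val f z = (if is_pole f z then sphere_infinity else stereo (remove_sings f z))"

section \<open>Normal and quasi-normal families\<close>

definition spherically_loc_unif_converges ::
    "(nat \<Rightarrow> complex \<Rightarrow> complex) \<Rightarrow> (complex \<Rightarrow> complex \<times> real) \<Rightarrow> complex set \<Rightarrow> bool"
  where "spherically_loc_unif_converges F g A \<longleftrightarrow>
    (\<forall>z\<in>A. \<exists>U. open U \<and> z \<in> U \<and>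
       uniform_limit (U \<inter> A) (\<lambda>n. sphere_val (F n)) g sequentially)"

definition quasi_normal_family_on :: "(complex \<Rightarrow> complex) set \<Rightarrow> complex set \<Rightarrow> bool"
  where "quasi_normal_family_on \<F> D \<longleftrightarrow>
    (\<forall>F :: nat \<Rightarrow> complex \<Rightarrow> complex. (\<forall>n. F n \<in> \<F>) \<longrightarrow>
       (\<exists>(r :: nat \<Rightarrow> nat) E g. strict_mono r \<and> E \<subseteq> D \<and> (\<forall>z\<in>D. \<not> z islimpt E) \<and>
          spherically_loc_unif_converges (F \<circ> r) g (D - E)))"

definition normal_family_on :: "(complex \<Rightarrow> complex) set \<Rightarrow> complex set \<Rightarrow> bool"
  where "normal_family_on \<F> D \<longleftrightarrow>
    (\<forall>F :: nat \<Rightarrow> complex \<Rightarrow> complex. (\<forall>n. F n \<in> \<F>) \<longrightarrow>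
       (\<exists>(r :: nat \<Rightarrow> nat) g. strict_mono r \<and> spherically_loc_unif_converges (F \<circ> r) g D))"

definition loc_unif_bounded_on :: "(complex \<Rightarrow> complex) set \<Rightarrow> complex set \<Rightarrow> bool"
  where "loc_unif_bounded_on \<F> D \<longleftrightarrow>
    (\<forall>z\<in>D. \<exists>U C. open U \<and> z \<in> U \<and>
       (\<forall>f\<in>\<F>. \<forall>w\<in>U \<inter> D. \<not> is_pole f w \<and> cmod (remove_sings f w) \<le> C))"

section \<open>Generalized Schwarzian derivatives\<close>

text \<open>
  \<open>schwarzian_aux k n f\<close> is $S_{k,n}(f)$ for \<open>k \<ge> 2\<close>; the values for \<open>k < 2\<close> are junk.
  \<^const>\<open>remove_sings\<close> picks the representative of the meromorphic function that is continuous off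
  its poles (and 0 at the poles).
\<close>

primrec schwarzian_aux :: "nat \<Rightarrow> nat \<Rightarrow> (complex \<Rightarrow> complex) \<Rightarrow> complex \<Rightarrow> complex"
  where
    "schwarzian_aux 0 n f = (\<lambda>_. 0)"
  | "schwarzian_aux (Suc k) n f =
       (if k < 2 then remove_sings (\<lambda>z. deriv (deriv f) z / deriv f z)
        else remove_sings (\<lambda>z. deriv (schwarzian_aux k n f) z
               - 1 / of_nat n * (deriv (deriv f) z / deriv f z) * schwarzian_aux k n f z))"

definition schwarzian :: "nat \<Rightarrow> (complex \<Rightarrow> complex) \<Rightarrow> complex \<Rightarrow> complex"
  where "schwarzian k f = schwarzian_aux (k + 1) k f"

definition schwarzian_norm :: "nat \<Rightarrow> (complex \<Rightarrow> complex) \<Rightarrow> ereal"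
  where "schwarzian_norm k f =
    (if f constant_on \<bbbD> then \<infinity>
     else (SUP z\<in>\<bbbD>. if is_pole (schwarzian k f) z then \<infinity> else ereal (cmod (schwarzian k f z))))"

definition schwarzian_family :: "nat \<Rightarrow> real \<Rightarrow> (complex \<Rightarrow> complex) set"  (\<open>\<H>\<close>)
  where "\<H> k M = {f. f holomorphic_on \<bbbD> \<and> schwarzian_norm k f \<le> ereal M}"

end

theory Submission
  imports Defs
begin

text \<open>
  If $f \in \mathcal{H}_{k,M}$, then $f'$ has no zeros, since $S_k(f)$ would have a pole there. Hence
  $h = (f')^{-1/k}$ is a zero-free holomorphic solution of the linear equation
  $h^{(k)} = -\frac{1}{k} S_k(f)\, h$ with bounded coefficient. When the vector of initial values
  at $0$ is normalized to length $1$, such $h$ are uniformly bounded by Gronwall's inequality, and by the theorems of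
  Montel and Hurwitz their limits are zero-free. So $f'/f'(0)$ and its reciprocal are
  locally uniformly bounded on the class, and Cauchy's estimate gives (i).

  For a sequence $f_n$ write $f_n = b_n (a_n + g_n)$ with $b_n = f_n'(0)$, $g_n(0) = 0$. After
  passing to a subsequence, $g_n$ converges locally uniformly to some $G$ with zero-free derivative,
  and each of $a_n$, $b_n$, $a_n b_n = f_n(0)$ converges or tends to infinity. The limits of $f_n'$,
  $f_n/f_n'$ and $f_n$ are then read off in each case; exceptional points arise only when
  $b_n \to \infty$ and $a_n \to a$, where they are the zeros of $a + G$.
\<close>

section \<open>Zeros of the derivative and the linear differential equation\<close>

lemma holomorphic_imp_remove_sings_eq:
  assumes "open U" "g holomorphic_on U" "z \<in> U"
  shows "remove_sings g z = g z"
  using assms analytic_on_analytic_at analytic_on_open remove_sings_at_analytic by blast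

lemma holomorphic_remove_sings:
  assumes "open U" "g holomorphic_on U"
  shows "remove_sings g holomorphic_on U"
  using assms holomorphic_imp_remove_sings_eq holomorphic_cong by metis

lemma holomorphic_log_deriv:
  assumes "open U" "f holomorphic_on U" "\<And>z. z \<in> U \<Longrightarrow> f z \<noteq> 0"
  shows "(\<lambda>z. deriv f z / f z) holomorphic_on U"
  using assms by (intro holomorphic_intros holomorphic_deriv) auto

lemma schwarzian_aux_2:
  "schwarzian_aux (Suc (Suc 0)) n f = remove_sings (\<lambda>z. deriv (deriv f) z / deriv f z)"
  by simp

text \<open>Where \<open>deriv f\<close> has no zeros the recursion creates no singularities. Every
  \<open>remove_sings\<close> then acts as the identity, which justifies reading the definition as a
  plain pointwise recursion. Indices of the form \<open>Suc (Suc j)\<close> start at S_2 and so stay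
  clear of the junk values.\<close>

lemma schwarzian_aux_step_regular:
  assumes "open U" "f holomorphic_on U" "\<And>z. z \<in> U \<Longrightarrow> deriv f z \<noteq> 0"
    and "schwarzian_aux (Suc (Suc j)) n f holomorphic_on U"
  shows "(\<lambda>z. deriv (schwarzian_aux (Suc (Suc j)) n f) z
           - 1 / of_nat n * (deriv (deriv f) z / deriv f z) * schwarzian_aux (Suc (Suc j)) n f z)
           holomorphic_on U"
  by (intro holomorphic_intros holomorphic_deriv) (use assms in \<open>auto intro: holomorphic_deriv\<close>)

lemma holomorphic_schwarzian_aux:
  assumes "open U" "f holomorphic_on U" "\<And>z. z \<in> U \<Longrightarrow> deriv f z \<noteq> 0"
  shows "schwarzian_aux (Suc (Suc j)) n f holomorphic_on U"
proof (induction j)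
  case 0
  show ?case
    unfolding schwarzian_aux_2 using assms
    by (intro holomorphic_remove_sings holomorphic_log_deriv holomorphic_deriv)
next
  case (Suc j)
  from holomorphic_remove_sings[OF assms(1) schwarzian_aux_step_regular[OF assms Suc]]
  show ?case by simp
qed

lemma schwarzian_aux_2_eq:
  assumes "open U" "f holomorphic_on U" "\<And>z. z \<in> U \<Longrightarrow> deriv f z \<noteq> 0" "z \<in> U"
  shows "schwarzian_aux (Suc (Suc 0)) n f z = deriv (deriv f) z / deriv f z"
  unfolding schwarzian_aux_2 using assms
  by (intro holomorphic_imp_remove_sings_eq holomorphic_log_deriv holomorphic_deriv)

lemma schwarzian_aux_Suc_eq:
  assumes "open U" "f holomorphic_on U" "\<And>z. z \<in> U \<Longrightarrow> deriv f z \<noteq> 0" "z \<in> U"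
  shows "schwarzian_aux (Suc (Suc (Suc j))) n f z = deriv (schwarzian_aux (Suc (Suc j)) n f) z
           - 1 / of_nat n * (deriv (deriv f) z / deriv f z) * schwarzian_aux (Suc (Suc j)) n f z"
proof -
  note hol = schwarzian_aux_step_regular[OF assms(1,2,3)
      holomorphic_schwarzian_aux[OF assms(1,2,3)], of j n]
  from holomorphic_imp_remove_sings_eq[OF assms(1) hol assms(4)] show ?thesis by simp
qed

declare schwarzian_aux.simps(2) [simp del]

text \<open>
  At a zero of \<^term>\<open>deriv f\<close> of order \<^term>\<open>d\<close>, $S_{m,n}(f)$ has a pole of order exactly $m - 1$: passing from
  $S_{m,n}$ to $S_{m+1,n}$ multiplies the leading coefficient by $-(m - 1 + d/n) \neq 0$.
\<close>

lemma schwarzian_aux_at_critical_point: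
  assumes "r > 0" "n > 0" "d > 0"
    and "f holomorphic_on ball z0 r" "g holomorphic_on ball z0 r"
    and "\<And>w. w \<in> ball z0 r \<Longrightarrow> g w \<noteq> 0"
    and df: "\<And>w. w \<in> ball z0 r \<Longrightarrow> deriv f w = (w - z0) ^ d * g w"
  shows "\<exists>T. T holomorphic_on ball z0 r \<and> T z0 \<noteq> 0 \<and>
    (\<forall>w \<in> ball z0 r - {z0}. schwarzian_aux (Suc (Suc j)) n f w = T w / (w - z0) ^ Suc j)"
proof -
  let ?B = "ball z0 r" and ?U = "ball z0 r - {z0}"
  \<comment> \<open>The holomorphic continuation of (w - z0) f''/f' to z0. Its value there is d, the
    residue of f''/f'.\<close>
  define A where "A = (\<lambda>w. of_nat d + (w - z0) * (deriv g w / g w))"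
  have holA: "A holomorphic_on ?B"
    unfolding A_def using assms by (intro holomorphic_intros holomorphic_log_deriv) auto
  have U: "open ?U" "f holomorphic_on ?U" "\<And>w. w \<in> ?U \<Longrightarrow> deriv f w \<noteq> 0"
    using assms by (auto intro: holomorphic_on_subset)
  have ddf: "deriv (deriv f) w / deriv f w = A w / (w - z0)" if w: "w \<in> ?U" for w
  proof -
    have "(deriv f has_field_derivative (of_nat d * (w - z0) ^ (d - 1) * g w + (w - z0) ^ d * deriv g w)) (at w)"
    proof (rule has_field_derivative_transform_within_open[where S = ?B])
      have "(g has_field_derivative deriv g w) (at w)"
        using assms w by (intro holomorphic_derivI[of g ?B]) auto
      then show "((\<lambda>w. (w - z0) ^ d * g w) has_field_derivative
          (of_nat d * (w - z0) ^ (d - 1) * g w + (w - z0) ^ d * deriv g w)) (at w)"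
        by (auto intro!: derivative_eq_intros simp: algebra_simps)
    qed (use w df in auto)
    then have "deriv (deriv f) w = of_nat d * (w - z0) ^ (d - 1) * g w + (w - z0) ^ d * deriv g w"
      by (rule DERIV_imp_deriv)
    moreover have "(w - z0) ^ d = (w - z0) * (w - z0) ^ (d - 1)"
      using \<open>d > 0\<close> by (cases d) auto
    ultimately show ?thesis
      using w assms(6)[of w] df[of w] by (simp add: A_def divide_simps) (simp add: algebra_simps)
  qed
  show ?thesis
  proof (induction j)
    case 0
    show ?case
    proof (intro exI[of _ A] conjI ballI holA)
      show "A z0 \<noteq> 0" using \<open>d > 0\<close> by (simp add: A_def)
      show "schwarzian_aux (Suc (Suc 0)) n f w = A w / (w - z0) ^ Suc 0" if "w \<in> ?U" for w
        using schwarzian_aux_2_eq[OF U that] ddf[OF that] by simp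
    qed
  next
    case (Suc j)
    then obtain T where T: "T holomorphic_on ?B" "T z0 \<noteq> 0"
      "\<And>w. w \<in> ?U \<Longrightarrow> schwarzian_aux (Suc (Suc j)) n f w = T w / (w - z0) ^ Suc j"
      by blast
    \<comment> \<open>Numerator of the next function over (w - z0)^(j+2): the quotient rule yields
      the first two terms, and f''/f' = A/(w - z0) yields the third. At z0 only -(j + 1 + d/n) times
      \<open>T z0\<close> survives.\<close>
    define T' where "T' = (\<lambda>w. (w - z0) * deriv T w - of_nat (Suc j) * T w - 1 / of_nat n * A w * T w)"
    show ?case
    proof (intro exI[of _ T'] conjI ballI)
      show "T' holomorphic_on ?B"
        unfolding T'_def by (intro holomorphic_intros holomorphic_deriv T holA) auto
      have "T' z0 = - (of_nat (Suc j * n + d) / of_nat n) * T z0"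
        using \<open>n > 0\<close> by (simp add: T'_def A_def field_simps)
      then show "T' z0 \<noteq> 0"
        using T(2) assms by (simp del: of_nat_add of_nat_Suc of_nat_mult)
    next
      fix w assume w: "w \<in> ?U"
      have "(schwarzian_aux (Suc (Suc j)) n f has_field_derivative
          (deriv T w / (w - z0) ^ Suc j - of_nat (Suc j) * T w / (w - z0) ^ Suc (Suc j))) (at w)"
      proof (rule has_field_derivative_transform_within_open[where S = ?U])
        have "(T has_field_derivative deriv T w) (at w)"
          using T w by (intro holomorphic_derivI[of T ?B]) auto
        moreover have "((\<lambda>w. (w - z0) ^ Suc j) has_field_derivative of_nat (Suc j) * (w - z0) ^ j) (at w)"
          by (auto intro!: derivative_eq_intros simp del: power_Suc of_nat_Suc)
        ultimately have "((\<lambda>w. T w / (w - z0) ^ Suc j) has_field_derivative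
            (deriv T w * (w - z0) ^ Suc j - T w * (of_nat (Suc j) * (w - z0) ^ j)) /
            ((w - z0) ^ Suc j * (w - z0) ^ Suc j)) (at w)"
          by (rule DERIV_divide) (use w in auto)
        also have "(deriv T w * (w - z0) ^ Suc j - T w * (of_nat (Suc j) * (w - z0) ^ j)) /
            ((w - z0) ^ Suc j * (w - z0) ^ Suc j) =
            deriv T w / (w - z0) ^ Suc j - of_nat (Suc j) * T w / (w - z0) ^ Suc (Suc j)"
          using w by (simp add: diff_divide_distrib)
        finally show "((\<lambda>w. T w / (w - z0) ^ Suc j) has_field_derivative
            (deriv T w / (w - z0) ^ Suc j - of_nat (Suc j) * T w / (w - z0) ^ Suc (Suc j))) (at w)" .
      qed (use w T(3) in auto)
      then have D: "deriv (schwarzian_aux (Suc (Suc j)) n f) w =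
          deriv T w / (w - z0) ^ Suc j - of_nat (Suc j) * T w / (w - z0) ^ Suc (Suc j)"
        by (rule DERIV_imp_deriv)
      have "w - z0 \<noteq> 0" using w by simp
      have "schwarzian_aux (Suc (Suc (Suc j))) n f w =
          deriv (schwarzian_aux (Suc (Suc j)) n f) w
          - 1 / of_nat n * (deriv (deriv f) w / deriv f w) * schwarzian_aux (Suc (Suc j)) n f w"
        by (rule schwarzian_aux_Suc_eq[OF U w])
      also have "\<dots> = T' w / (w - z0) ^ Suc (Suc j)"
        using \<open>w - z0 \<noteq> 0\<close> unfolding D ddf[OF w] T(3)[OF w] T'_def
        by (simp add: diff_divide_distrib)
      finally show "schwarzian_aux (Suc (Suc (Suc j))) n f w = T' w / (w - z0) ^ Suc (Suc j)" .
    qed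
  qed
qed

section \<open>Members of the family: zero-free derivative and the associated linear
  equation\<close>

lemma not_constant_on_schwarzian_family:
  "f \<in> \<H> k M \<Longrightarrow> \<not> f constant_on \<bbbD>"
  by (auto simp: schwarzian_family_def schwarzian_norm_def)

lemma schwarzian_family_bound:
  assumes "f \<in> \<H> k M" "z \<in> \<bbbD>"
  shows "\<not> is_pole (schwarzian k f) z" "cmod (schwarzian k f z) \<le> M"
proof -
  have "(SUP z\<in>\<bbbD>. if is_pole (schwarzian k f) z then \<infinity> else ereal (cmod (schwarzian k f z))) \<le> ereal M"
    using assms not_constant_on_schwarzian_family[OF assms(1)]
    by (simp add: schwarzian_family_def schwarzian_norm_def)
  then have *: "(if is_pole (schwarzian k f) z then \<infinity> else ereal (cmod (schwarzian k f z))) \<le> ereal M"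
    using assms(2) by (simp only: SUP_le_iff)
  then show "\<not> is_pole (schwarzian k f) z" by (auto split: if_splits)
  with * show "cmod (schwarzian k f z) \<le> M" by simp
qed

text \<open>A zero of f' of any finite order forces a pole of order k of S_k(f), which is
  incompatible with a finite supremum.\<close>

lemma schwarzian_family_deriv_nz:
  assumes "k \<ge> 1" "f \<in> \<H> k M" "z0 \<in> \<bbbD>"
  shows "deriv f z0 \<noteq> 0"
proof
  assume z0: "deriv f z0 = 0"
  have hol: "f holomorphic_on \<bbbD>" using assms by (simp add: schwarzian_family_def)
  have hol': "deriv f holomorphic_on \<bbbD>" using hol by (simp add: holomorphic_deriv)
  \<comment> \<open>This guarantees that the zero has finite order: a constant f' vanishing at z0
    would make f constant, and constants have norm infinity.\<close>
  have "\<not> deriv f constant_on \<bbbD>"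
  proof
    assume "deriv f constant_on \<bbbD>"
    then have "deriv f w = 0" if "w \<in> \<bbbD>" for w
      using z0 that assms(3) by (auto simp: constant_on_def)
    then have "(f has_field_derivative 0) (at w within \<bbbD>)" if "w \<in> \<bbbD>" for w
      using holomorphic_derivI[OF hol open_ball that, of "\<bbbD>"] that by simp
    then have "\<exists>c. \<forall>w\<in>\<bbbD>. f w = c"
      using has_field_derivative_zero_constant[OF convex_ball] by blast
    then have "f constant_on \<bbbD>" by (simp add: constant_on_def)
    with not_constant_on_schwarzian_family assms show False by blast
  qed
  then obtain g r d where d: "0 < d" "0 < r" and sub: "ball z0 r \<subseteq> \<bbbD>"
      and holg: "g holomorphic_on ball z0 r"
      and geq: "\<And>w. w \<in> ball z0 r \<Longrightarrow> deriv f w = (w - z0)^d * g w"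
      and gnz: "\<And>w. w \<in> ball z0 r \<Longrightarrow> g w \<noteq> 0"
    by (blast intro: holomorphic_factor_zero_nonconstant[OF hol' open_ball connected_ball assms(3) z0])
  \<comment> \<open>S_k is \<open>schwarzian_aux (k + 1) k\<close>, so its index is
    \<open>Suc (Suc j)\<close> and the pole has order \<open>Suc j\<close>, that is, k.\<close>
  obtain j where j: "k = Suc j" using assms(1) by (cases k) auto
  obtain T where T: "T holomorphic_on ball z0 r" "T z0 \<noteq> 0"
    "\<And>w. w \<in> ball z0 r - {z0} \<Longrightarrow> schwarzian_aux (Suc (Suc j)) k f w = T w / (w - z0) ^ Suc j"
    using schwarzian_aux_at_critical_point[of r k d f z0 g j] d assms(1) hol holg gnz geq
      holomorphic_on_subset[OF hol sub] by auto
  have "is_pole (\<lambda>w. T w / (w - z0) ^ Suc j) z0"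
    by (rule is_pole_basic[OF T(1)]) (use d T in auto)
  moreover have "eventually (\<lambda>w. T w / (w - z0) ^ Suc j = schwarzian k f w) (at z0)"
    using eventually_at_ball'[OF d(2), of z0 UNIV]
    by eventually_elim (use T(3) j in \<open>auto simp: schwarzian_def\<close>)
  ultimately have "is_pole (schwarzian k f) z0"
    using is_pole_transform by blast
  with schwarzian_family_bound assms show False by blast
qed

text \<open>
  The function is $h = (f')^{-1/k}$. The generalized Schwarzian derivatives are made so that
  $h^{(j)} = -\frac{1}{k} S_{j+1,k}(f)\, h$ for $j \ge 1$.
\<close>

lemma schwarzian_family_root:
  assumes "k \<ge> 1" "f \<in> \<H> k M"
  obtains h where "h holomorphic_on \<bbbD>" "\<And>z. z \<in> \<bbbD> \<Longrightarrow> h z \<noteq> 0"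
    "\<And>z. z \<in> \<bbbD> \<Longrightarrow> deriv f z = 1 / h z ^ k"
    "\<And>z. z \<in> \<bbbD> \<Longrightarrow> cmod ((deriv ^^ k) h z) \<le> M / real k * cmod (h z)"
proof -
  have hol: "f holomorphic_on \<bbbD>" using assms by (simp add: schwarzian_family_def)
  have hol': "deriv f holomorphic_on \<bbbD>" using hol by (simp add: holomorphic_deriv)
  note nz = schwarzian_family_deriv_nz[OF assms]
  have k: "k > 0" using assms by simp
  obtain g where g: "g holomorphic_on \<bbbD>" "\<And>z. z \<in> \<bbbD> \<Longrightarrow> exp (g z) = deriv f z"
    using holomorphic_logarithm_exists[OF convex_ball open_ball hol' nz, of 0] by auto
  \<comment> \<open>A branch of the k-th root of 1/f', available because the zero-free f' has a
    logarithm on the disk.\<close>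
  define h where "h = (\<lambda>z. exp (- g z / of_nat k))"
  have holh: "h holomorphic_on \<bbbD>"
    unfolding h_def using k by (intro holomorphic_intros g) auto
  have hk: "deriv f z = 1 / h z ^ k" if "z \<in> \<bbbD>" for z
  proof -
    have "h z ^ k = exp (- g z)" using k by (simp add: h_def flip: exp_of_nat_mult)
    then show ?thesis using g(2)[OF that] by (simp add: exp_minus inverse_eq_divide)
  qed
  have dg: "deriv g z = deriv (deriv f) z / deriv f z" if z: "z \<in> \<bbbD>" for z
  proof -
    have "((\<lambda>z. exp (g z)) has_field_derivative exp (g z) * deriv g z) (at z)"
      using holomorphic_derivI[OF g(1) open_ball z, of UNIV]
      by (auto intro!: derivative_eq_intros)
    then have "(deriv f has_field_derivative exp (g z) * deriv g z) (at z)"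
      by (rule has_field_derivative_transform_within_open[where S = \<bbbD>]) (use z g in auto)
    then have "deriv (deriv f) z = deriv f z * deriv g z"
      using DERIV_imp_deriv g(2)[OF z] by metis
    then show ?thesis using nz[OF z] by simp
  qed
  have dh: "(h has_field_derivative - 1 / of_nat k * (deriv (deriv f) z / deriv f z) * h z) (at z)"
    if z: "z \<in> \<bbbD>" for z
    using holomorphic_derivI[OF g(1) open_ball z, of UNIV] k unfolding h_def dg[OF z]
    by (auto intro!: derivative_eq_intros simp: mult_ac)
  have *: "(deriv ^^ Suc j) h z = - 1 / of_nat k * schwarzian_aux (Suc (Suc j)) k f z * h z"
    if "z \<in> \<bbbD>" for z j
    using that
  proof (induction j arbitrary: z)
    case 0
    then show ?case
      using DERIV_imp_deriv[OF dh[OF 0]] schwarzian_aux_2_eq[OF open_ball hol nz 0]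
      by simp
  next
    case (Suc j)
    let ?S = "schwarzian_aux (Suc (Suc j)) k f"
    have holS: "?S holomorphic_on \<bbbD>"
      using holomorphic_schwarzian_aux[OF open_ball hol nz] .
    \<comment> \<open>Product rule for -(1/k) S h with h' = -(1/k)(f''/f') h. Taking out the factor
      h leaves S' - (1/k)(f''/f') S, the next generalized Schwarzian.\<close>
    let ?D = "- 1 / of_nat k * (?S z * (- 1 / of_nat k * (deriv (deriv f) z / deriv f z) * h z) + deriv ?S z * h z)"
    have "((deriv ^^ Suc j) h has_field_derivative ?D) (at z)"
    proof (rule has_field_derivative_transform_within_open[where S = \<bbbD>])
      show "((\<lambda>z. - 1 / of_nat k * (?S z * h z)) has_field_derivative ?D) (at z)"
        using holomorphic_derivI[OF holS open_ball Suc.prems, of UNIV] dh[OF Suc.prems]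
        by (intro DERIV_cmult DERIV_mult')
    qed (use Suc in \<open>auto simp: mult.assoc\<close>)
    then have "(deriv ^^ Suc (Suc j)) h z = ?D"
      using DERIV_imp_deriv by (metis funpow.simps(2) o_apply)
    moreover have "schwarzian_aux (Suc (Suc (Suc j))) k f z = deriv ?S z
        - 1 / of_nat k * (deriv (deriv f) z / deriv f z) * ?S z"
      by (rule schwarzian_aux_Suc_eq[OF open_ball hol nz Suc.prems])
    ultimately show ?case by (simp only:) (simp add: algebra_simps)
  qed
  obtain j where j: "k = Suc j" using k by (cases k) auto
  have "cmod ((deriv ^^ k) h z) \<le> M / real k * cmod (h z)" if z: "z \<in> \<bbbD>" for z
  proof -
    have "cmod ((deriv ^^ k) h z) = cmod (schwarzian k f z) / real k * cmod (h z)"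
      using *[OF z, of j] j
      by (simp add: schwarzian_def norm_mult norm_divide del: funpow.simps of_nat_Suc)
    also have "\<dots> \<le> M / real k * cmod (h z)"
      using schwarzian_family_bound(2)[OF assms(2) z] by (intro mult_right_mono divide_right_mono) auto
    finally show ?thesis .
  qed
  with holh hk show ?thesis by (intro that[of h]) (auto simp: h_def)
qed

text \<open>Gronwall's inequality for $\sum_{j<k} |h^{(j)}(tz)|^2$ as a function of $t \in [0,1]$.\<close>

lemma linear_ode_bound:
  assumes hol: "h holomorphic_on \<bbbD>" and "k \<ge> 1"
    and ode: "\<And>z. z \<in> \<bbbD> \<Longrightarrow> cmod ((deriv ^^ k) h z) \<le> C * cmod (h z)"
    and z: "z \<in> \<bbbD>"
  shows "(cmod (h z))\<^sup>2 \<le> exp (2 + C\<^sup>2) * (\<Sum>j<k. (cmod ((deriv ^^ j) h 0))\<^sup>2)"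
proof -
  \<comment> \<open>The squared length of the vector of derivatives along the segment from 0 to z.
    The chain rule brings in a factor z, which |z| < 1 allows to be dropped in estimates.\<close>
  define u where "u = (\<lambda>t::real. \<Sum>j<k. (cmod ((deriv ^^ j) h (of_real t * z)))\<^sup>2)"
  define v where "v = (\<lambda>j t. (deriv ^^ j) h (of_real t * z))"
  define u' where "u' = (\<lambda>t. \<Sum>j<k. 2 * (v j t \<bullet> (z * v (Suc j) t)))"
  \<comment> \<open>After 2xy \<le> x^2 + y^2, one \<open>u t\<close> comes from the terms of index
    j and one from those of index j + 1 below k. The term of index k is at most
    \<open>C\<^sup>2 * u t\<close> by the equation.\<close>
  define L where "L = 2 + C\<^sup>2"
  have tz: "of_real t * z \<in> \<bbbD>" if "0 \<le> t" "t \<le> 1" for t :: real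
  proof -
    have "t * cmod z \<le> cmod z" using that by (simp add: mult_left_le_one_le)
    then show ?thesis using z that by (simp add: norm_mult)
  qed
  have dv: "(v j has_vector_derivative z * v (Suc j) t) (at t)" if t: "0 \<le> t" "t \<le> 1" for j t
  proof -
    have "((deriv ^^ j) h has_field_derivative (deriv ^^ Suc j) h (of_real t * z)) (at (of_real t * z))"
      using holomorphic_derivI[OF holomorphic_higher_deriv[OF hol open_ball] open_ball tz[OF t]] by simp
    moreover have "((\<lambda>t. of_real t * z) has_vector_derivative z) (at t)"
      by (auto intro!: derivative_eq_intros)
    ultimately show ?thesis
      unfolding v_def using field_vector_diff_chain_at[of "\<lambda>t. of_real t * z" z t "(deriv ^^ j) h"]
      by (simp add: o_def)
  qed
  have du: "(u has_real_derivative u' t) (at t)" if t: "0 \<le> t" "t \<le> 1" for t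
  proof -
    have "((\<lambda>t. v j t \<bullet> v j t) has_real_derivative 2 * (v j t \<bullet> (z * v (Suc j) t))) (at t)" for j
      using bounded_bilinear.has_vector_derivative[OF bounded_bilinear_inner,
        OF dv[OF t, of j] dv[OF t, of j]]
      by (simp add: has_real_derivative_iff_has_vector_derivative inner_commute)
    then show ?thesis
      unfolding u_def u'_def by (auto intro!: derivative_intros simp: v_def power2_norm_eq_inner)
  qed
  have u'_le: "u' t \<le> L * u t" if t: "0 \<le> t" "t \<le> 1" for t
  proof -
    have "u' t \<le> (\<Sum>j<k. (cmod (v j t))\<^sup>2 + (cmod (v (Suc j) t))\<^sup>2)"
      unfolding u'_def
    proof (rule sum_mono)
      fix j
      have "v j t \<bullet> (z * v (Suc j) t) \<le> cmod (v j t) * cmod (z * v (Suc j) t)"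
        by (rule norm_cauchy_schwarz)
      also have "\<dots> \<le> cmod (v j t) * cmod (v (Suc j) t)"
        using z by (intro mult_left_mono) (auto simp: norm_mult mult_left_le_one_le)
      finally have "2 * (v j t \<bullet> (z * v (Suc j) t)) \<le> 2 * cmod (v j t) * cmod (v (Suc j) t)" by simp
      also have "\<dots> \<le> (cmod (v j t))\<^sup>2 + (cmod (v (Suc j) t))\<^sup>2" by (rule sum_squares_bound)
      finally show "2 * (v j t \<bullet> (z * v (Suc j) t)) \<le> (cmod (v j t))\<^sup>2 + (cmod (v (Suc j) t))\<^sup>2" .
    qed
    also have "\<dots> = u t + (\<Sum>j<k. (cmod (v (Suc j) t))\<^sup>2)"
      by (simp add: sum.distrib u_def v_def)
    also have "(\<Sum>j<k. (cmod (v (Suc j) t))\<^sup>2) \<le> u t + C\<^sup>2 * u t"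
    proof -
      have "(\<Sum>j<Suc k. (cmod (v j t))\<^sup>2) = (cmod (v 0 t))\<^sup>2 + (\<Sum>j<k. (cmod (v (Suc j) t))\<^sup>2)"
        by (rule sum.lessThan_Suc_shift)
      then have "(\<Sum>j<k. (cmod (v (Suc j) t))\<^sup>2) \<le> (\<Sum>j<Suc k. (cmod (v j t))\<^sup>2)" by simp
      also have "\<dots> = u t + (cmod (v k t))\<^sup>2" by (simp add: u_def v_def)
      also have "(cmod (v k t))\<^sup>2 \<le> (C * cmod (v 0 t))\<^sup>2"
        using ode[OF tz[OF t]] by (intro power_mono) (auto simp: v_def)
      also have "\<dots> = C\<^sup>2 * (cmod (v 0 t))\<^sup>2" by (simp add: power_mult_distrib)
      also have "(cmod (v 0 t))\<^sup>2 \<le> u t"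
        unfolding u_def v_def
        by (rule member_le_sum[where i = "0::nat" and f = "\<lambda>j. (cmod ((deriv ^^ j) h (of_real t * z)))\<^sup>2"])
          (use \<open>k \<ge> 1\<close> in auto)
      finally show ?thesis by (simp add: mult_left_mono)
    qed
    finally show ?thesis by (simp add: L_def algebra_simps)
  qed
  \<comment> \<open>The integrating factor turns u' \<le> L u into monotonicity on [0,1].\<close>
  have "exp (- L * 1) * u 1 \<le> exp (- L * 0) * u 0"
  proof (rule DERIV_nonpos_imp_nonincreasing[where f = "\<lambda>t. exp (- L * t) * u t"])
    fix t :: real assume t: "0 \<le> t" "t \<le> 1"
    have "((\<lambda>t. exp (- L * t) * u t) has_real_derivative exp (- L * t) * (u' t - L * u t)) (at t)"
      using du[OF t] by (auto intro!: derivative_eq_intros simp: algebra_simps)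
    moreover have "exp (- L * t) * (u' t - L * u t) \<le> 0"
      using u'_le[OF t] by (intro mult_nonneg_nonpos) auto
    ultimately show "\<exists>y. ((\<lambda>t. exp (- L * t) * u t) has_real_derivative y) (at t) \<and> y \<le> 0" by blast
  qed simp
  then have "u 1 \<le> exp L * u 0" by (simp add: exp_minus field_simps)
  moreover have "(cmod (h z))\<^sup>2 \<le> u 1"
    using member_le_sum[where i = "0::nat" and f = "\<lambda>j. (cmod ((deriv ^^ j) h z))\<^sup>2" and A = "{..<k}"] \<open>k \<ge> 1\<close>
    by (auto simp: u_def)
  ultimately show ?thesis by (simp add: u_def L_def)
qed

section \<open>Compactness of the normalized solutions\<close>

text \<open>Half the minimum of |v| on K bounds v from below and leaves room for the error of u_n,
  so one constant serves the sequence and its limit.\<close>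

lemma uniform_limit_bounded_below:
  fixes u :: "'c \<Rightarrow> 'a::topological_space \<Rightarrow> 'b::real_normed_vector"
  assumes lim: "uniform_limit K u v F" and K: "compact K" "continuous_on K v"
    and nz: "\<forall>z\<in>K. v z \<noteq> 0"
  obtains \<delta> where "\<delta> > 0" "eventually (\<lambda>n. \<forall>z\<in>K. \<delta> \<le> norm (u n z)) F"
    "\<forall>z\<in>K. \<delta> \<le> norm (v z)"
proof (cases "K = {}")
  case True
  then show ?thesis by (intro that[of 1]) auto
next
  case False
  have "continuous_on K (\<lambda>z. norm (v z))" using K(2) by (intro continuous_intros)
  then obtain x where x: "x \<in> K" "\<And>z. z \<in> K \<Longrightarrow> norm (v x) \<le> norm (v z)"
    using continuous_attains_inf[OF K(1) False] by blast
  have pos: "norm (v x) / 2 > 0" using nz x(1) by simp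
  show ?thesis
  proof (rule that[OF pos])
    show "eventually (\<lambda>n. \<forall>z\<in>K. norm (v x) / 2 \<le> norm (u n z)) F"
      using uniform_limitD[OF lim pos]
    proof eventually_elim
      case (elim n)
      show ?case
      proof
        fix z assume z: "z \<in> K"
        have "norm (v z) - norm (u n z) \<le> norm (u n z - v z)"
          by (metis norm_minus_commute norm_triangle_ineq2)
        then show "norm (v x) / 2 \<le> norm (u n z)"
          using elim z x(2)[OF z] by (auto simp: dist_norm)
      qed
    qed
    have "norm (v x) / 2 \<le> norm (v z)" if "z \<in> K" for z
      using x(2)[OF that] pos by linarith
    then show "\<forall>z\<in>K. norm (v x) / 2 \<le> norm (v z)" by blast
  qed
qed

text \<open>The equation is linear, so its solution may be rescaled freely; the scaling reappears
  only in the constant c. With initial vector of length 1 the Gronwall bound depends on M and k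
  alone.\<close>

lemma schwarzian_family_normalized_root:
  assumes "k \<ge> 1" "f \<in> \<H> k M"
  obtains h c where "h holomorphic_on \<bbbD>" "\<And>z. z \<in> \<bbbD> \<Longrightarrow> h z \<noteq> 0"
    "\<And>z. z \<in> \<bbbD> \<Longrightarrow> deriv f z = c / h z ^ k" "c \<noteq> 0"
    "(\<Sum>j<k. (cmod ((deriv ^^ j) h 0))\<^sup>2) = 1"
    "\<And>z. z \<in> \<bbbD> \<Longrightarrow> cmod (h z) \<le> sqrt (exp (2 + (M / real k)\<^sup>2))"
proof -
  obtain g where g: "g holomorphic_on \<bbbD>" "\<And>z. z \<in> \<bbbD> \<Longrightarrow> g z \<noteq> 0"
    "\<And>z. z \<in> \<bbbD> \<Longrightarrow> deriv f z = 1 / g z ^ k"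
    "\<And>z. z \<in> \<bbbD> \<Longrightarrow> cmod ((deriv ^^ k) g z) \<le> M / real k * cmod (g z)"
    using schwarzian_family_root[OF assms] by metis
  \<comment> \<open>Length of the initial vector. It is positive because its entry of index 0 is
    g(0), which is nonzero; the constant c becomes s^(-k).\<close>
  define s where "s = sqrt (\<Sum>j<k. (cmod ((deriv ^^ j) g 0))\<^sup>2)"
  define h where "h = (\<lambda>z. of_real (1 / s) * g z)"
  have "(cmod (g 0))\<^sup>2 \<le> (\<Sum>j<k. (cmod ((deriv ^^ j) g 0))\<^sup>2)"
    using member_le_sum[where i = "0::nat" and f = "\<lambda>j. (cmod ((deriv ^^ j) g 0))\<^sup>2" and A = "{..<k}"]
      assms(1) by auto
  moreover have "(cmod (g 0))\<^sup>2 > 0" using g(2)[of 0] by simp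
  ultimately have s: "s > 0" unfolding s_def by (intro real_sqrt_gt_zero) linarith
  have dh: "(deriv ^^ j) h z = of_real (1 / s) * (deriv ^^ j) g z" if "z \<in> \<bbbD>" for j z
    unfolding h_def by (rule higher_deriv_cmult[OF g(1) that open_ball])
  have holh: "h holomorphic_on \<bbbD>" unfolding h_def by (intro holomorphic_intros g)
  have ode: "cmod ((deriv ^^ k) h z) \<le> M / real k * cmod (h z)" if "z \<in> \<bbbD>" for z
  proof -
    have "cmod ((deriv ^^ k) h z) = (1 / s) * cmod ((deriv ^^ k) g z)"
      using s by (simp add: dh[OF that] norm_mult norm_divide)
    also have "\<dots> \<le> (1 / s) * (M / real k * cmod (g z))"
      using s by (intro mult_left_mono g that) auto
    also have "\<dots> = M / real k * cmod (h z)" using s by (simp add: h_def norm_mult norm_divide)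
    finally show ?thesis .
  qed
  have norm1: "(\<Sum>j<k. (cmod ((deriv ^^ j) h 0))\<^sup>2) = 1"
  proof -
    have "(\<Sum>j<k. (cmod ((deriv ^^ j) h 0))\<^sup>2) = (\<Sum>j<k. (1 / s\<^sup>2) * (cmod ((deriv ^^ j) g 0))\<^sup>2)"
      using s by (intro sum.cong) (auto simp: dh norm_mult norm_divide power_divide power_mult_distrib)
    also have "\<dots> = (1 / s\<^sup>2) * (\<Sum>j<k. (cmod ((deriv ^^ j) g 0))\<^sup>2)"
      by (rule sum_distrib_left[symmetric])
    also have "(\<Sum>j<k. (cmod ((deriv ^^ j) g 0))\<^sup>2) = s\<^sup>2" by (simp add: s_def sum_nonneg)
    finally show ?thesis using s by simp
  qed
  show ?thesis
  proof (rule that[OF holh _ _ _ norm1])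
    show "h z \<noteq> 0" if "z \<in> \<bbbD>" for z using g(2)[OF that] s by (simp add: h_def)
    show "deriv f z = of_real (1 / s) ^ k / h z ^ k" if "z \<in> \<bbbD>" for z
      using g(3)[OF that] s by (simp add: h_def power_mult_distrib power_divide)
    show "of_real (1 / s) ^ k \<noteq> (0::complex)" using s by simp
    show "cmod (h z) \<le> sqrt (exp (2 + (M / real k)\<^sup>2))" if "z \<in> \<bbbD>" for z
      using linear_ode_bound[OF holh assms(1) ode that] norm1 by (intro real_le_rsqrt) simp
  qed
qed

text \<open>By Hurwitz the limit is zero-free or constant. The constant 0 is excluded because
  derivatives at 0 converge along with the functions, so that the normalized sum 1 would tend to
  0.\<close>

lemma normalized_limit_nz:
  assumes hol: "\<And>n. h n holomorphic_on \<bbbD>" and nz: "\<And>n z. z \<in> \<bbbD> \<Longrightarrow> h n z \<noteq> 0"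
    and norm1: "\<And>n. (\<Sum>j<k. (cmod ((deriv ^^ j) (h n) 0))\<^sup>2) = 1"
    and lim: "l holomorphic_on \<bbbD>" "\<And>K. compact K \<Longrightarrow> K \<subseteq> \<bbbD> \<Longrightarrow> uniform_limit K h l sequentially"
    and z: "z \<in> \<bbbD>"
  shows "l z \<noteq> 0"
proof (cases "l constant_on \<bbbD>")
  case False
  then show ?thesis
    using Hurwitz_no_zeros[OF open_ball connected_ball hol lim(1) lim(2) _ nz z] by blast
next
  case True
  show ?thesis
  proof
    assume "l z = 0"
    with True z have l0: "l w = 0" if "w \<in> \<bbbD>" for w using that by (auto simp: constant_on_def)
    \<comment> \<open>Any disk about 0 with closure inside the unit disk works: uniform convergence
      on it gives convergence of all derivatives at its centre.\<close>
    let ?B = "ball 0 (1/2) :: complex set"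
    have "uniform_limit (cball 0 (1/2)) h l sequentially" by (intro lim) auto
    then have "uniform_limit ?B h (\<lambda>_. 0) sequentially"
      using l0 by (subst uniform_limit_cong'[where g = h and i = l]) (auto intro: uniform_limit_on_subset)
    moreover have "eventually (\<lambda>n. h n holomorphic_on ?B) sequentially"
      by (intro always_eventually allI holomorphic_on_subset[OF hol]) auto
    ultimately have "(\<lambda>n. (deriv ^^ j) (h n) 0) \<longlonglongrightarrow> (deriv ^^ j) (\<lambda>_. 0) 0" for j
      by (rule higher_deriv_complex_uniform_limit) auto
    moreover have "(deriv ^^ j) (\<lambda>_. 0) 0 = (0 :: complex)" for j
      by (induction j) (auto simp: higher_deriv_const)
    ultimately have "(\<lambda>n. (deriv ^^ j) (h n) 0) \<longlonglongrightarrow> 0" for j by simp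
    then have "(\<lambda>n. \<Sum>j<k. (cmod ((deriv ^^ j) (h n) 0))\<^sup>2) \<longlonglongrightarrow> (\<Sum>j<k. (cmod 0)\<^sup>2)"
      by (intro tendsto_intros)
    then show False by (simp add: norm1 LIMSEQ_const_iff)
  qed
qed

text \<open>Compactness argument: counterexamples to the bounds B = n yield normalized solutions,
  for which Montel gives a zero-free limit along a subsequence. Upper and lower bounds for these
  solutions then contradict the growth in n.\<close>

lemma schwarzian_family_deriv_ratio_bounds:
  assumes k: "k \<ge> 1" and K: "compact K" "K \<subseteq> \<bbbD>"
  shows "\<exists>B. \<forall>f\<in>\<H> k M. \<forall>z\<in>K. cmod (deriv f z / deriv f 0) \<le> B \<and> cmod (deriv f 0 / deriv f z) \<le> B"
proof (rule ccontr)
  assume neg: "\<not> ?thesis"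
  define P where "P = (\<lambda>n f z. f \<in> \<H> k M \<and> z \<in> K \<and>
    (cmod (deriv f z / deriv f 0) > real n \<or> cmod (deriv f 0 / deriv f z) > real n))"
  have "\<exists>f z. P n f z" for n
  proof -
    have "\<exists>f\<in>\<H> k M. \<exists>z\<in>K. \<not> (cmod (deriv f z / deriv f 0) \<le> real n \<and> cmod (deriv f 0 / deriv f z) \<le> real n)"
      using neg by blast
    then show ?thesis unfolding P_def by (auto simp: not_le)
  qed
  then obtain f z where P: "\<And>n. P n (f n) (z n)" by metis
  then have f: "\<And>n. f n \<in> \<H> k M" and z: "\<And>n. z n \<in> K"
    and large: "\<And>n. cmod (deriv (f n) (z n) / deriv (f n) 0) > real n \<or> cmod (deriv (f n) 0 / deriv (f n) (z n)) > real n"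
    unfolding P_def by blast+
  define E where "E = sqrt (exp (2 + (M / real k)\<^sup>2))"
  define Q where "Q = (\<lambda>n h c. h holomorphic_on \<bbbD> \<and> (\<forall>z\<in>\<bbbD>. h z \<noteq> 0) \<and>
    (\<forall>z\<in>\<bbbD>. deriv (f n) z = c / h z ^ k) \<and> c \<noteq> 0 \<and>
    (\<Sum>j<k. (cmod ((deriv ^^ j) h 0))\<^sup>2) = 1 \<and> (\<forall>z\<in>\<bbbD>. cmod (h z) \<le> E))"
  have "\<exists>h c. Q n h c" for n
    unfolding Q_def E_def by (rule schwarzian_family_normalized_root[OF k f[of n]]) blast
  then obtain h c where Q: "\<And>n. Q n (h n) (c n)" by metis
  have h: "h n holomorphic_on \<bbbD>" "c n \<noteq> 0" "(\<Sum>j<k. (cmod ((deriv ^^ j) (h n) 0))\<^sup>2) = 1"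
    "z \<in> \<bbbD> \<Longrightarrow> h n z \<noteq> 0" "z \<in> \<bbbD> \<Longrightarrow> deriv (f n) z = c n / h n z ^ k"
    "z \<in> \<bbbD> \<Longrightarrow> cmod (h n z) \<le> E" for n z
    using Q[of n] unfolding Q_def by blast+
  obtain l r where l: "l holomorphic_on \<bbbD>" and r: "strict_mono (r :: nat \<Rightarrow> nat)"
    and lim: "\<And>K. compact K \<Longrightarrow> K \<subseteq> \<bbbD> \<Longrightarrow> uniform_limit K (h \<circ> r) l sequentially"
  proof (rule Montel[of \<bbbD> "range h" h])
    show "\<exists>B. \<forall>h\<in>range h. \<forall>z\<in>K. norm (h z) \<le> B" if "compact K" "K \<subseteq> \<bbbD>" for K
      using h(6) that(2) by (intro exI[of _ E]) auto
  qed (use h in auto)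
  have lnz: "l z \<noteq> 0" if "z \<in> \<bbbD>" for z
    by (rule normalized_limit_nz[where h = "h \<circ> r" and k = k]) (use h l lim that in auto)
  \<comment> \<open>The base point 0 of the ratios has to be covered by the lower bound as
    well.\<close>
  let ?K = "insert 0 K"
  have K': "compact ?K" "?K \<subseteq> \<bbbD>" using K by auto
  obtain \<delta> where \<delta>: "\<delta> > 0" "eventually (\<lambda>n. \<forall>z\<in>?K. \<delta> \<le> cmod ((h \<circ> r) n z)) sequentially"
  proof (rule uniform_limit_bounded_below[OF lim[OF K'] K'(1)])
    show "continuous_on ?K l"
      using holomorphic_on_imp_continuous_on[OF holomorphic_on_subset[OF l K'(2)]] .
    show "\<forall>z\<in>?K. l z \<noteq> 0" using lnz K'(2) by blast
  qed
  \<comment> \<open>The uncontrolled constants c_n cancel in the ratio. Letting x and y range over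
    the same set covers the ratio and its reciprocal at once.\<close>
  have ratio: "cmod (deriv (f n) x / deriv (f n) y) \<le> (E / \<delta>) ^ k"
    if "x \<in> ?K" "y \<in> ?K" "\<forall>z\<in>?K. \<delta> \<le> cmod (h n z)" for n x y
  proof -
    have xy: "x \<in> \<bbbD>" "y \<in> \<bbbD>" using that K' by auto
    have "deriv (f n) x / deriv (f n) y = (h n y / h n x) ^ k"
      using h(4)[of x n] h(4)[of y n] h(2)[of n] xy by (simp add: h(5) power_divide)
    then have "cmod (deriv (f n) x / deriv (f n) y) = (cmod (h n y) / cmod (h n x)) ^ k"
      by (simp add: norm_power norm_divide)
    also have "\<dots> \<le> (E / \<delta>) ^ k"
      using that \<delta>(1) h(6)[OF xy(2), of n] by (intro power_mono frac_le) (auto intro: order_trans[OF norm_ge_zero])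
    finally show ?thesis .
  qed
  obtain N where N: "\<And>n. n \<ge> N \<Longrightarrow> \<forall>z\<in>?K. \<delta> \<le> cmod (h (r n) z)"
    using \<delta>(2) by (auto simp: eventually_sequentially)
  \<comment> \<open>Since \<open>r m\<close> is at least m, both ratios of index \<open>r m\<close>
    are at most \<open>real (r m)\<close>, whereas one of them was chosen larger.\<close>
  define m where "m = max N (nat \<lceil>(E / \<delta>) ^ k\<rceil>)"
  have "real (r m) \<ge> real m" using seq_suble[OF r, of m] by simp
  moreover have "real m \<ge> (E / \<delta>) ^ k" by (simp add: m_def) linarith
  moreover have "cmod (deriv (f (r m)) (z (r m)) / deriv (f (r m)) 0) \<le> (E / \<delta>) ^ k"
    "cmod (deriv (f (r m)) 0 / deriv (f (r m)) (z (r m))) \<le> (E / \<delta>) ^ k"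
    using z by (auto intro!: ratio N simp: m_def)
  ultimately show False using large[of "r m"] by linarith
qed

section \<open>Local boundedness of f''/f'\<close>

lemma schwarzian_family_pre_schwarzian_bounded:
  assumes k: "k \<ge> 1"
  shows "loc_unif_bounded_on {\<lambda>z. deriv (deriv f) z / deriv f z | f. f \<in> \<H> k M} \<bbbD>"
  unfolding loc_unif_bounded_on_def
proof
  fix z0 :: complex assume "z0 \<in> \<bbbD>"
  then obtain e where e: "e > 0" "cball z0 e \<subseteq> \<bbbD>"
    by (meson open_ball open_contains_cball)
  \<comment> \<open>Closed disks of radius r about points of \<open>ball z0 r\<close> stay inside
    \<open>cball z0 e\<close>, where the ratio bounds hold.\<close>
  define r where "r = e / 2"
  have r: "r > 0" using e by (simp add: r_def)
  obtain B where B: "\<And>f z. f \<in> \<H> k M \<Longrightarrow> z \<in> cball z0 e \<Longrightarrow>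
      cmod (deriv f z / deriv f 0) \<le> B \<and> cmod (deriv f 0 / deriv f z) \<le> B"
    using schwarzian_family_deriv_ratio_bounds[OF k compact_cball e(2), of M] by blast
  show "\<exists>U C. open U \<and> z0 \<in> U \<and>
      (\<forall>g\<in>{\<lambda>z. deriv (deriv f) z / deriv f z | f. f \<in> \<H> k M}.
        \<forall>w\<in>U \<inter> \<bbbD>. \<not> is_pole g w \<and> cmod (remove_sings g w) \<le> C)"
  proof (intro exI[of _ "ball z0 r"] exI[of _ "B / r * B"] conjI ballI)
    fix g w assume "g \<in> {\<lambda>z. deriv (deriv f) z / deriv f z | f. f \<in> \<H> k M}" and w: "w \<in> ball z0 r \<inter> \<bbbD>"
    then obtain f where f: "f \<in> \<H> k M" and g: "g = (\<lambda>z. deriv (deriv f) z / deriv f z)" by blast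
    note nz = schwarzian_family_deriv_nz[OF k f]
    have hol: "deriv f holomorphic_on \<bbbD>"
      using f by (auto simp: schwarzian_family_def intro: holomorphic_deriv)
    have holg: "g holomorphic_on \<bbbD>"
      unfolding g by (rule holomorphic_log_deriv[OF open_ball hol nz])
    show "\<not> is_pole g w" using not_is_pole_holomorphic[OF open_ball _ holg] w by blast
    have sub: "cball w r \<subseteq> cball z0 e"
    proof
      fix x assume "x \<in> cball w r"
      then show "x \<in> cball z0 e" using w dist_triangle[of z0 x w] by (simp add: r_def)
    qed
    have wK: "w \<in> cball z0 e" using w r by (auto simp: r_def)
    have hol': "deriv f holomorphic_on cball w r" using hol sub e by (meson holomorphic_on_subset subset_trans)
    \<comment> \<open>Cauchy's estimate bounds f''(w) by a multiple of f'(0); dividing by f'(w) and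
      using the bound for f'(0)/f'(w) then removes f'(0).\<close>
    have "cmod ((deriv ^^ 1) (deriv f) w) \<le> fact 1 * (B * cmod (deriv f 0)) / r ^ 1"
    proof (rule Cauchy_inequality)
      fix x assume "cmod (w - x) = r"
      then have "x \<in> cball z0 e" using sub by (auto simp: dist_norm)
      from B[OF f this] show "cmod (deriv f x) \<le> B * cmod (deriv f 0)"
        using nz[of 0] by (simp add: norm_divide field_simps)
    qed (use r hol' in \<open>auto intro: holomorphic_on_subset holomorphic_on_imp_continuous_on\<close>)
    then have "cmod (deriv (deriv f) w) \<le> B / r * cmod (deriv f 0)" by simp
    then have "cmod (g w) \<le> B / r * cmod (deriv f 0) / cmod (deriv f w)"
      unfolding g norm_divide by (rule divide_right_mono) simp
    also have "\<dots> = B / r * cmod (deriv f 0 / deriv f w)" by (simp add: norm_divide)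
    also have "\<dots> \<le> B / r * B"
      using order_trans[OF norm_ge_zero conjunct1[OF B[OF f wK]]] B[OF f wK] r by (intro mult_left_mono) auto
    finally show "cmod (remove_sings g w) \<le> B / r * B"
      using holomorphic_imp_remove_sings_eq[OF open_ball holg] w by simp
  qed (use r in auto)
qed

section \<open>Extraction of subsequences\<close>

lemma subsequence_convergent_or_at_infinity:
  fixes c :: "nat \<Rightarrow> 'a::euclidean_space"
  obtains r :: "nat \<Rightarrow> nat" where "strict_mono r"
    "convergent (c \<circ> r) \<or> filterlim (c \<circ> r) at_infinity sequentially"
proof (cases "filterlim c at_infinity sequentially")
  case True
  then show ?thesis using that[of id] by (simp add: strict_mono_id)
next
  case False
  then obtain B where "\<not> eventually (\<lambda>n. B \<le> norm (c n)) sequentially"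
    by (auto simp: filterlim_at_infinity[of 0])
  \<comment> \<open>Failure of divergence to infinity leaves infinitely many terms in one bounded
    ball; enumerating them gives a sequence to which compactness applies.\<close>
  then have inf: "infinite {n. norm (c n) < B}"
    by (simp add: not_eventually INFM_iff_infinite cofinite_eq_sequentially[symmetric] not_le)
  define s where "s = enumerate {n. norm (c n) < B}"
  have s: "strict_mono s" unfolding s_def by (rule strict_mono_enumerate[OF inf])
  have "(c \<circ> s) n \<in> cball 0 B" for n
    using enumerate_in_set[OF inf, of n] by (simp add: s_def less_imp_le)
  then obtain l t where "strict_mono t" "((c \<circ> s) \<circ> t) \<longlonglongrightarrow> l"
    using compact_cball[of 0 B] unfolding compact_eq_seq_compact_metric seq_compact_def by meson
  then show ?thesis
    using that[of "s \<circ> t"] s by (auto simp: strict_mono_o convergent_def o_assoc)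
qed

text \<open>Ensures that alternatives settled by earlier extractions survive later ones.\<close>

lemma convergent_or_at_infinity_subseq:
  assumes "convergent c \<or> filterlim c at_infinity sequentially" "strict_mono r"
  shows "convergent (c \<circ> r) \<or> filterlim (c \<circ> r) at_infinity sequentially"
  using assms convergent_subseq_convergent filterlim_compose[OF _ filterlim_subseq[OF assms(2)]]
  unfolding o_def by blast

text \<open>Replaces K by a convex set containing 0, on which the mean value inequality can be
  applied from 0.\<close>

lemma compact_subset_unit_disk:
  assumes "compact K" "K \<subseteq> \<bbbD>"
  obtains \<rho> where "0 \<le> \<rho>" "\<rho> < 1" "K \<subseteq> cball 0 \<rho>"
proof (cases "K = {}")
  case True
  then show ?thesis using that[of 0] by auto
next
  case False
  obtain x where "x \<in> K" "\<And>y. y \<in> K \<Longrightarrow> norm y \<le> norm x"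
    using continuous_attains_sup[OF assms(1) False continuous_on_norm_id] by blast
  then show ?thesis using assms(2) by (intro that[of "norm x"]) auto
qed

lemma uniform_limit_comp_subseq:
  assumes "uniform_limit K u v sequentially" "strict_mono r"
  shows "uniform_limit K (\<lambda>n. u (r n)) v sequentially"
  using filterlim_compose[OF assms(1) filterlim_subseq[OF assms(2)]] .

text \<open>Montel is applied to f_n'/f_n'(0) only. The limit of the normalized functions is the
  primitive vanishing at 0, and their convergence follows from that of the derivatives by the mean
  value inequality.\<close>

lemma schwarzian_family_normal_form:
  assumes k: "k \<ge> 1" and f: "\<And>n. f n \<in> \<H> k M"
  obtains r :: "nat \<Rightarrow> nat" and G where "strict_mono r" "G holomorphic_on \<bbbD>"
    "\<forall>z\<in>\<bbbD>. deriv G z \<noteq> 0"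
    "\<forall>K. compact K \<longrightarrow> K \<subseteq> \<bbbD> \<longrightarrow>
      uniform_limit K (\<lambda>n z. (f (r n) z - f (r n) 0) / deriv (f (r n)) 0) G sequentially"
    "\<forall>K. compact K \<longrightarrow> K \<subseteq> \<bbbD> \<longrightarrow>
      uniform_limit K (\<lambda>n z. deriv (f (r n)) z / deriv (f (r n)) 0) (deriv G) sequentially"
proof -
  define p where "p = (\<lambda>n z. deriv (f n) z / deriv (f n) 0)"
  note nz = schwarzian_family_deriv_nz[OF k f]
  have hol: "f n holomorphic_on \<bbbD>" for n using f by (simp add: schwarzian_family_def)
  have holp: "p n holomorphic_on \<bbbD>" for n
    unfolding p_def by (intro holomorphic_intros holomorphic_deriv hol) (auto simp: nz)
  obtain P r where P: "P holomorphic_on \<bbbD>" and r: "strict_mono (r :: nat \<Rightarrow> nat)"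
    and ptw: "\<And>z. z \<in> \<bbbD> \<Longrightarrow> (\<lambda>n. p (r n) z) \<longlonglongrightarrow> P z"
    and lim: "\<And>K. compact K \<Longrightarrow> K \<subseteq> \<bbbD> \<Longrightarrow> uniform_limit K (p \<circ> r) P sequentially"
  proof (rule Montel[of \<bbbD> "range p" p])
    fix K :: "complex set" assume K: "compact K" "K \<subseteq> \<bbbD>"
    obtain B where "\<And>f z. f \<in> \<H> k M \<Longrightarrow> z \<in> K \<Longrightarrow> cmod (deriv f z / deriv f 0) \<le> B"
      using schwarzian_family_deriv_ratio_bounds[OF k K, of M] by blast
    then show "\<exists>B. \<forall>h\<in>range p. \<forall>z\<in>K. norm (h z) \<le> B"
      using f by (auto simp: p_def)
  qed (use holp in auto)
  \<comment> \<open>The bound on the reciprocals f_n'(0)/f_n'(z) keeps the ratios away from 0, and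
    this passes to the limit.\<close>
  have Pnz: "P z \<noteq> 0" if z: "z \<in> \<bbbD>" for z
  proof
    assume P0: "P z = 0"
    have Kz: "compact {z}" "{z} \<subseteq> \<bbbD>" using z by auto
    obtain B where B: "\<And>f. f \<in> \<H> k M \<Longrightarrow> cmod (deriv f 0 / deriv f z) \<le> B"
      using schwarzian_family_deriv_ratio_bounds[OF k Kz, of M] by blast
    have B': "1 \<le> B * cmod (p (r n) z)" for n
      using B[OF f[of "r n"]] nz[OF z, of "r n"] nz[of 0 "r n"]
      by (simp add: p_def norm_divide field_simps)
    have "(\<lambda>n. B * cmod (p (r n) z)) \<longlonglongrightarrow> B * cmod 0"
      using ptw[OF z] unfolding P0 by (intro tendsto_intros)
    then have "1 \<le> B * cmod 0"
      using B' by (intro LIMSEQ_le_const) auto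
    then show False by simp
  qed
  obtain G0 where G0: "\<And>z. z \<in> \<bbbD> \<Longrightarrow> (G0 has_field_derivative P z) (at z within \<bbbD>)"
    using holomorphic_convex_primitive'[OF convex_ball open_ball P] by blast
  define G where "G = (\<lambda>z. G0 z - G0 0)"
  have dG: "(G has_field_derivative P z) (at z)" if "z \<in> \<bbbD>" for z
  proof -
    have "(G0 has_field_derivative P z) (at z)"
      using G0[OF that] that at_within_open[OF that open_ball] by simp
    then show ?thesis unfolding G_def by (auto intro!: derivative_eq_intros)
  qed
  have dG': "deriv G z = P z" if "z \<in> \<bbbD>" for z using dG[OF that] by (rule DERIV_imp_deriv)
  show ?thesis
  proof (rule that[OF r])
    show "G holomorphic_on \<bbbD>" using dG holomorphic_on_open[OF open_ball] by blast
    show "\<forall>z\<in>\<bbbD>. deriv G z \<noteq> 0" using dG' Pnz by simp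
    have "uniform_limit K (\<lambda>n z. deriv (f (r n)) z / deriv (f (r n)) 0) (deriv G) sequentially"
      if K: "compact K" "K \<subseteq> \<bbbD>" for K
    proof -
      have "uniform_limit K (\<lambda>n z. deriv (f (r n)) z / deriv (f (r n)) 0) (deriv G) sequentially
        \<longleftrightarrow> uniform_limit K (p \<circ> r) P sequentially"
        by (rule uniform_limit_cong') (use K dG' in \<open>auto simp: p_def\<close>)
      then show ?thesis using lim[OF K] by blast
    qed
    then show "\<forall>K. compact K \<longrightarrow> K \<subseteq> \<bbbD> \<longrightarrow>
      uniform_limit K (\<lambda>n z. deriv (f (r n)) z / deriv (f (r n)) 0) (deriv G) sequentially"
      by blast
    have "uniform_limit K (\<lambda>n z. (f (r n) z - f (r n) 0) / deriv (f (r n)) 0) G sequentially"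
      if K: "compact K" "K \<subseteq> \<bbbD>" for K
    proof (rule uniform_limitI)
      fix e :: real assume e: "e > 0"
      obtain \<rho> where \<rho>: "0 \<le> \<rho>" "\<rho> < 1" "K \<subseteq> cball 0 \<rho>"
        using compact_subset_unit_disk[OF K] .
      have sub: "cball 0 \<rho> \<subseteq> \<bbbD>" using \<rho> by auto
      \<comment> \<open>Halving e restores the strict inequality after the mean value inequality,
        which yields only a weak one.\<close>
      have "e / 2 > 0" using e by simp
      from uniform_limitD[OF lim[OF compact_cball sub] this]
      show "\<forall>\<^sub>F n in sequentially. \<forall>z\<in>K. dist ((f (r n) z - f (r n) 0) / deriv (f (r n)) 0) (G z) < e"
      proof eventually_elim
        case (elim n)
        show ?case
        proof
          fix z assume z: "z \<in> K"
          \<comment> \<open>Both terms vanish at 0, so an increment of this difference from 0 is its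
            value.\<close>
          let ?\<phi> = "\<lambda>z. (f (r n) z - f (r n) 0) / deriv (f (r n)) 0 - G z"
          have z\<rho>: "z \<in> cball 0 \<rho>" using z \<rho> by blast
          have "cmod (?\<phi> z - ?\<phi> 0) \<le> e / 2 * cmod (z - 0)"
          proof (rule field_differentiable_bound[where S = "cball 0 \<rho>"])
            fix w :: complex assume w: "w \<in> cball 0 \<rho>"
            then have "w \<in> \<bbbD>" using sub by blast
            then have "(f (r n) has_field_derivative deriv (f (r n)) w) (at w within cball 0 \<rho>)"
              by (intro holomorphic_derivI[OF hol open_ball])
            moreover have "(G has_field_derivative P w) (at w within cball 0 \<rho>)"
              using dG[OF \<open>w \<in> \<bbbD>\<close>] has_field_derivative_at_within by blast
            ultimately show "(?\<phi> has_field_derivative p (r n) w - P w) (at w within cball 0 \<rho>)"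
              using nz[of 0 "r n"] unfolding p_def by (auto intro!: derivative_eq_intros)
            show "cmod (p (r n) w - P w) \<le> e / 2"
              using elim w by (auto simp: dist_norm intro: less_imp_le)
          qed (use \<rho> z\<rho> in auto)
          also have "\<dots> \<le> e / 2 * 1"
            using \<rho> z\<rho> e by (intro mult_left_mono) auto
          finally show "dist ((f (r n) z - f (r n) 0) / deriv (f (r n)) 0) (G z) < e"
            using e by (simp add: dist_norm G_def)
        qed
      qed
    qed
    then show "\<forall>K. compact K \<longrightarrow> K \<subseteq> \<bbbD> \<longrightarrow>
      uniform_limit K (\<lambda>n z. (f (r n) z - f (r n) 0) / deriv (f (r n)) 0) G sequentially"
      by blast
  qed
qed

text \<open>The common starting point for f'/f, f' and f. The product c_n = f_n(0) is followed
  separately because b_n \<rightarrow> 0 and a_n \<rightarrow> \<infinity> together do not determine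
  its behaviour.\<close>

lemma schwarzian_family_subsequence:
  assumes k: "k \<ge> 1" and f: "\<And>n. f n \<in> \<H> k M"
  obtains r :: "nat \<Rightarrow> nat" and G :: "complex \<Rightarrow> complex" and g p :: "nat \<Rightarrow> complex \<Rightarrow> complex"
    and a b c :: "nat \<Rightarrow> complex"
  where "strict_mono r" "G holomorphic_on \<bbbD>" "\<forall>z\<in>\<bbbD>. deriv G z \<noteq> 0"
    "\<forall>n. b n \<noteq> 0 \<and> c n = b n * a n"
    "\<forall>n z. f (r n) z = b n * (a n + g n z)" "\<forall>n z. deriv (f (r n)) z = b n * p n z"
    "\<forall>K. compact K \<longrightarrow> K \<subseteq> \<bbbD> \<longrightarrow> uniform_limit K g G sequentially"
    "\<forall>K. compact K \<longrightarrow> K \<subseteq> \<bbbD> \<longrightarrow> uniform_limit K p (deriv G) sequentially"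
    "convergent a \<or> filterlim a at_infinity sequentially"
    "convergent b \<or> filterlim b at_infinity sequentially"
    "convergent c \<or> filterlim c at_infinity sequentially"
proof -
  note nz = schwarzian_family_deriv_nz[OF k f]
  define g where "g = (\<lambda>n z. (f n z - f n 0) / deriv (f n) 0)"
  define p where "p = (\<lambda>n z. deriv (f n) z / deriv (f n) 0)"
  define c where "c = (\<lambda>n. f n 0)"
  define b where "b = (\<lambda>n. deriv (f n) 0)"
  define a where "a = (\<lambda>n. c n / b n)"
  obtain r0 G where r0: "strict_mono r0" and G: "G holomorphic_on \<bbbD>"
    "\<forall>z\<in>\<bbbD>. deriv G z \<noteq> 0"
    and g: "\<forall>K. compact K \<longrightarrow> K \<subseteq> \<bbbD> \<longrightarrow>
      uniform_limit K (\<lambda>n z. (f (r0 n) z - f (r0 n) 0) / deriv (f (r0 n)) 0) G sequentially"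
    and p: "\<forall>K. compact K \<longrightarrow> K \<subseteq> \<bbbD> \<longrightarrow>
      uniform_limit K (\<lambda>n z. deriv (f (r0 n)) z / deriv (f (r0 n)) 0) (deriv G) sequentially"
    using schwarzian_family_normal_form[where f = f, OF k f] .
  obtain r1 where r1: "strict_mono r1"
    "convergent ((a \<circ> r0) \<circ> r1) \<or> filterlim ((a \<circ> r0) \<circ> r1) at_infinity sequentially"
    using subsequence_convergent_or_at_infinity .
  obtain r2 where r2: "strict_mono r2"
    "convergent ((b \<circ> r0 \<circ> r1) \<circ> r2) \<or> filterlim ((b \<circ> r0 \<circ> r1) \<circ> r2) at_infinity sequentially"
    using subsequence_convergent_or_at_infinity .
  obtain r3 where r3: "strict_mono r3"
    "convergent ((c \<circ> r0 \<circ> r1 \<circ> r2) \<circ> r3) \<or> filterlim ((c \<circ> r0 \<circ> r1 \<circ> r2) \<circ> r3) at_infinity sequentially"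
    using subsequence_convergent_or_at_infinity .
  define s where "s = r1 \<circ> r2 \<circ> r3"
  have s: "strict_mono s" using r1 r2 r3 by (simp add: s_def strict_mono_o)
  have b0: "b n \<noteq> 0" for n using nz[of 0 n] by (simp add: b_def)
  show ?thesis
  proof (rule that[of "r0 \<circ> s" G "b \<circ> r0 \<circ> s" "c \<circ> r0 \<circ> s" "a \<circ> r0 \<circ> s" "\<lambda>n. g (r0 (s n))" "\<lambda>n. p (r0 (s n))"])
    show "strict_mono (r0 \<circ> s)" using r0 s by (rule strict_mono_o)
    show "\<forall>n. (b \<circ> r0 \<circ> s) n \<noteq> 0 \<and> (c \<circ> r0 \<circ> s) n = (b \<circ> r0 \<circ> s) n * (a \<circ> r0 \<circ> s) n"
      using b0 by (simp add: a_def)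
    show "\<forall>n z. f ((r0 \<circ> s) n) z = (b \<circ> r0 \<circ> s) n * ((a \<circ> r0 \<circ> s) n + g (r0 (s n)) z)"
      using b0 by (simp add: a_def b_def c_def g_def distrib_left)
    show "\<forall>n z. deriv (f ((r0 \<circ> s) n)) z = (b \<circ> r0 \<circ> s) n * p (r0 (s n)) z"
      using b0 by (simp add: b_def p_def)
    show "\<forall>K. compact K \<longrightarrow> K \<subseteq> \<bbbD> \<longrightarrow> uniform_limit K (\<lambda>n. g (r0 (s n))) G sequentially"
      using uniform_limit_comp_subseq[OF g[rule_format] s] unfolding g_def by blast
    show "\<forall>K. compact K \<longrightarrow> K \<subseteq> \<bbbD> \<longrightarrow> uniform_limit K (\<lambda>n. p (r0 (s n))) (deriv G) sequentially"
      using uniform_limit_comp_subseq[OF p[rule_format] s] unfolding p_def by blast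
    show "convergent (a \<circ> r0 \<circ> s) \<or> filterlim (a \<circ> r0 \<circ> s) at_infinity sequentially"
      using convergent_or_at_infinity_subseq[OF r1(2) strict_mono_o[OF r2(1) r3(1)]]
      by (simp only: s_def o_assoc)
    show "convergent (b \<circ> r0 \<circ> s) \<or> filterlim (b \<circ> r0 \<circ> s) at_infinity sequentially"
      using convergent_or_at_infinity_subseq[OF r2(2) r3(1)] by (simp only: s_def o_assoc)
    show "convergent (c \<circ> r0 \<circ> s) \<or> filterlim (c \<circ> r0 \<circ> s) at_infinity sequentially"
      using r3(2) by (simp only: s_def o_assoc)
  qed (use G in auto)
qed

section \<open>Convergence on the sphere\<close>

lemma dist_stereo_le: "dist (stereo a) (stereo b) \<le> 2 * dist a b"
proof -
  have "1 * 1 \<le> sqrt (1 + (cmod a)\<^sup>2) * sqrt (1 + (cmod b)\<^sup>2)"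
    by (intro mult_mono) auto
  then have "2 * cmod (a - b) / (sqrt (1 + (cmod a)\<^sup>2) * sqrt (1 + (cmod b)\<^sup>2)) \<le> 2 * cmod (a - b) / 1"
    by (intro divide_left_mono) auto
  then show ?thesis unfolding dist_stereo by (simp add: dist_norm)
qed

text \<open>
  The reciprocal on the sphere. As it is an isometry, $f'/f$ can be studied through $f/f'$, which
  is holomorphic for $f \in \mathcal{H}_{k,M}$.
\<close>

definition stereo_inverse :: "complex \<Rightarrow> complex \<times> real"
  where "stereo_inverse w = (if w = 0 then sphere_infinity else stereo (inverse w))"

lemma sqrt_one_plus_norm_inverse:
  fixes b :: complex
  assumes "b \<noteq> 0"
  shows "sqrt (1 + (cmod (inverse b))\<^sup>2) = sqrt (1 + (cmod b)\<^sup>2) / cmod b"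
proof -
  have "1 + (cmod (inverse b))\<^sup>2 = (1 + (cmod b)\<^sup>2) / (cmod b)\<^sup>2"
    using assms by (simp add: norm_inverse power_inverse divide_inverse distrib_right)
  then show ?thesis by (simp add: real_sqrt_divide)
qed

lemma dist_stereo_inverse_stereo_0: "dist (stereo_inverse a) (stereo 0) = dist (stereo a) sphere_infinity"
proof (cases "a = 0")
  case True
  then show ?thesis by (simp add: stereo_inverse_def dist_commute)
next
  case False
  then show ?thesis
    unfolding stereo_inverse_def dist_stereo_infinity
    by (simp add: dist_stereo sqrt_one_plus_norm_inverse) (simp add: norm_inverse)
qed

lemma dist_stereo_inverse_infinity: "dist (stereo_inverse a) sphere_infinity = dist (stereo a) (stereo 0)"
  by (cases "a = 0")
    (auto simp: stereo_inverse_def dist_stereo_infinity dist_stereo sqrt_one_plus_norm_inverse)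

text \<open>Away from 0, the factor |a||b| gained from \<open>sqrt_one_plus_norm_inverse\<close>
  cancels the one in |1/a - 1/b| = |a - b|/(|a||b|). The two preceding lemmas settle the pairs
  involving 0.\<close>

lemma dist_stereo_inverse: "dist (stereo_inverse a) (stereo_inverse b) = dist (stereo a) (stereo b)"
proof (cases "a = 0 \<or> b = 0")
  case True
  then show ?thesis
    using dist_stereo_inverse_infinity[of a] dist_stereo_inverse_infinity[of b]
    by (auto simp: stereo_inverse_def dist_commute)
next
  case False
  then have "inverse a - inverse b = (b - a) / (a * b)" by (simp add: field_simps)
  then have "cmod (inverse a - inverse b) = cmod (a - b) / (cmod a * cmod b)"
    by (simp add: norm_divide norm_mult norm_minus_commute)
  then show ?thesis
    using False by (simp add: stereo_inverse_def dist_stereo sqrt_one_plus_norm_inverse)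
qed

lemma stereo_inverse_neq_infinity: "w \<noteq> 0 \<Longrightarrow> stereo_inverse w \<noteq> sphere_infinity"
  using dist_stereo_inverse_infinity[of w] by (auto simp: dist_stereo add_pos_nonneg less_imp_neq)

lemma stereo_neq_infinity: "stereo w \<noteq> sphere_infinity"
proof -
  have "1 + (cmod w)\<^sup>2 > 0" by (simp add: add_pos_nonneg)
  then have "dist (stereo w) sphere_infinity > 0" by (simp add: dist_stereo_infinity)
  then show ?thesis by auto
qed

section \<open>Uniform limits transported to the sphere\<close>

lemma uniform_limit_lipschitz_comp:
  fixes \<phi> :: "'b::metric_space \<Rightarrow> 'c::metric_space"
  assumes "uniform_limit K u v F" "\<And>a b. dist (\<phi> a) (\<phi> b) \<le> C * dist a b"
  shows "uniform_limit K (\<lambda>n z. \<phi> (u n z)) (\<lambda>z. \<phi> (v z)) F"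
proof (rule uniform_limitI)
  fix e :: real assume e: "e > 0"
  \<comment> \<open>The sign of C is arbitrary; the maximum makes \<open>e / C'\<close> a positive
    tolerance.\<close>
  define C' where "C' = max C 1"
  have C': "C' > 0" by (simp add: C'_def)
  then have "e / C' > 0" using e by simp
  from uniform_limitD[OF assms(1) this]
  show "\<forall>\<^sub>F n in F. \<forall>z\<in>K. dist (\<phi> (u n z)) (\<phi> (v z)) < e"
  proof eventually_elim
    case (elim n)
    show ?case
    proof
      fix z assume z: "z \<in> K"
      have "dist (\<phi> (u n z)) (\<phi> (v z)) \<le> C * dist (u n z) (v z)" by (rule assms)
      also have "\<dots> \<le> C' * dist (u n z) (v z)" by (intro mult_right_mono) (auto simp: C'_def)
      also have "\<dots> < e" using elim z C' by (auto simp: field_simps)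
      finally show "dist (\<phi> (u n z)) (\<phi> (v z)) < e" .
    qed
  qed
qed

lemmas uniform_limit_stereo = uniform_limit_lipschitz_comp[OF _ dist_stereo_le]

text \<open>The isometry carries the Lipschitz bound over to reciprocals, so uniform convergence
  persists even across zeros of the limit, where the reciprocal has poles.\<close>

lemmas uniform_limit_stereo_inverse =
  uniform_limit_lipschitz_comp[OF _ dist_stereo_le[folded dist_stereo_inverse]]

lemma uniform_limit_stereo_infinity:
  assumes c: "filterlim c at_infinity F" and u: "uniform_limit K u v F"
    and K: "compact K" "continuous_on K v" "\<And>z. z \<in> K \<Longrightarrow> v z \<noteq> 0"
  shows "uniform_limit K (\<lambda>n z. stereo (c n * u n z)) (\<lambda>_. sphere_infinity) F"
proof (rule uniform_limitI)
  fix e :: real assume e: "e > 0"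
  have "\<forall>z\<in>K. v z \<noteq> 0" using K(3) by blast
  from uniform_limit_bounded_below[OF u K(1,2) this]
  obtain \<delta> where \<delta>: "\<delta> > 0" "eventually (\<lambda>n. \<forall>z\<in>K. \<delta> \<le> cmod (u n z)) F"
    by metis
  \<comment> \<open>Chosen so that |c_n u_n| \<ge> 2/e; the chordal distance 2/sqrt(1 + x^2) of a
    point of modulus x from infinity is then below e.\<close>
  have "eventually (\<lambda>n. 2 / (e * \<delta>) \<le> cmod (c n)) F"
    using c e \<delta> by (simp add: filterlim_at_infinity[of 0])
  with \<delta>(2) show "\<forall>\<^sub>F n in F. \<forall>z\<in>K. dist (stereo (c n * u n z)) sphere_infinity < e"
  proof eventually_elim
    case (elim n)
    show ?case
    proof
      fix z assume z: "z \<in> K"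
      let ?x = "cmod (c n * u n z)"
      have "2 / (e * \<delta>) * \<delta> \<le> ?x"
        unfolding norm_mult using elim z \<delta> by (intro mult_mono) auto
      then have "2 / e \<le> ?x" using \<delta> by simp
      also have "?x < sqrt (1 + ?x\<^sup>2)" by (rule real_less_rsqrt) simp
      finally have "2 / e < sqrt (1 + ?x\<^sup>2)" .
      then have "2 < e * sqrt (1 + ?x\<^sup>2)" using e by (simp add: field_simps)
      moreover have "sqrt (1 + ?x\<^sup>2) > 0" by (simp add: add_pos_nonneg)
      ultimately show "dist (stereo (c n * u n z)) sphere_infinity < e"
        by (simp add: dist_stereo_infinity pos_divide_less_eq)
    qed
  qed
qed

text \<open>Serves all expressions that occur: a_n + g_n, 1 + g_n/a_n, c_n + b_n g_n and b_n p_n.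
  Compactness supplies the bounded limits required for products.\<close>

lemma uniform_limit_affine:
  fixes g :: "nat \<Rightarrow> 'a::topological_space \<Rightarrow> 'b::real_normed_algebra"
  assumes "c \<longlonglongrightarrow> c0" "b \<longlonglongrightarrow> b0" "uniform_limit K g G sequentially" "compact K" "continuous_on K G"
  shows "uniform_limit K (\<lambda>n z. c n + b n * g n z) (\<lambda>z. c0 + b0 * G z) sequentially"
proof (rule uniform_limit_add[OF _ uniform_lim_mult])
  have const: "uniform_limit K (\<lambda>n z. d n) (\<lambda>z. d0) sequentially" if "d \<longlonglongrightarrow> d0" for d :: "nat \<Rightarrow> 'b" and d0
  proof (rule uniform_limitI)
    fix e :: real assume "e > 0"
    from tendstoD[OF that this] show "\<forall>\<^sub>F n in sequentially. \<forall>z\<in>K. dist (d n) d0 < e"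
      by (rule eventually_mono) blast
  qed
  show "uniform_limit K (\<lambda>n z. c n) (\<lambda>z. c0) sequentially" "uniform_limit K (\<lambda>n z. b n) (\<lambda>z. b0) sequentially"
    by (intro const assms)+
  show "uniform_limit K g G sequentially" by (rule assms)
  show "bounded (G ` K)" using assms by (intro compact_imp_bounded compact_continuous_image)
  show "bounded ((\<lambda>z. b0) ` K)" by (rule bounded_subset[of "{b0}"]) auto
qed

lemma spherically_loc_unif_convergesI:
  assumes "open A" "\<And>K. compact K \<Longrightarrow> K \<subseteq> A \<Longrightarrow> uniform_limit K (\<lambda>n. sphere_val (F n)) g sequentially"
  shows "spherically_loc_unif_converges F g A"
  unfolding spherically_loc_unif_converges_def
proof
  fix z assume "z \<in> A"
  then obtain e where e: "e > 0" "cball z e \<subseteq> A" using assms(1) open_contains_cball by blast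
  then have "uniform_limit (ball z e \<inter> A) (\<lambda>n. sphere_val (F n)) g sequentially"
    by (intro uniform_limit_on_subset[OF assms(2)[OF compact_cball e(2)]]) auto
  with e show "\<exists>U. open U \<and> z \<in> U \<and> uniform_limit (U \<inter> A) (\<lambda>n. sphere_val (F n)) g sequentially"
    by (intro exI[of _ "ball z e"]) auto
qed

lemma sphere_val_holomorphic:
  assumes "open A" "f holomorphic_on A" "z \<in> A"
  shows "sphere_val f z = stereo (f z)"
  using assms not_is_pole_holomorphic holomorphic_imp_remove_sings_eq by (simp add: sphere_val_def)

section \<open>The logarithmic derivatives f'/f\<close>

lemma sphere_val_log_deriv:
  assumes k: "k \<ge> 1" and f: "f \<in> \<H> k M" and z: "z \<in> \<bbbD>"
  shows "sphere_val (\<lambda>w. deriv f w / f w) z = stereo_inverse (f z / deriv f z)"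
proof -
  note nz = schwarzian_family_deriv_nz[OF k f]
  have hol: "f holomorphic_on \<bbbD>" using f by (simp add: schwarzian_family_def)
  have hol': "deriv f holomorphic_on \<bbbD>" using hol by (simp add: holomorphic_deriv)
  show ?thesis
  proof (cases "f z = 0")
    case True
    \<comment> \<open>A point where f is nonzero makes the zeros of f isolated; as f' is nonzero at
      z, the quotient has a pole there.\<close>
    obtain \<beta> where \<beta>: "\<beta> \<in> \<bbbD>" "f \<beta> \<noteq> 0"
      using not_constant_on_schwarzian_family[OF f] unfolding constant_on_def by metis
    have "is_pole (\<lambda>w. deriv f w / f w) z"
    proof (rule is_pole_divide)
      show "isCont (deriv f) z"
        using hol' z holomorphic_on_imp_continuous_on continuous_on_eq_continuous_at[OF open_ball] by blast
      have "isCont f z"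
        using hol z holomorphic_on_imp_continuous_on continuous_on_eq_continuous_at[OF open_ball] by blast
      then have "(f \<longlongrightarrow> 0) (at z)" using True by (simp add: isCont_def)
      moreover have "eventually (\<lambda>w. f w \<noteq> 0) (at z)"
        using non_zero_neighbour_alt[OF hol open_ball connected_ball z \<beta>] by (rule eventually_mono) simp
      ultimately show "filterlim f (at 0) (at z)" by (simp add: filterlim_at)
      show "deriv f z \<noteq> 0" by (rule nz[OF z])
    qed
    then show ?thesis using True by (simp add: sphere_val_def stereo_inverse_def)
  next
    case False
    have "continuous_on \<bbbD> f" using hol holomorphic_on_imp_continuous_on by blast
    then have op: "open (\<bbbD> \<inter> f -` (- {0}))"
      by (intro continuous_open_preimage) auto
    have "(\<lambda>w. deriv f w / f w) holomorphic_on (\<bbbD> \<inter> f -` (- {0}))"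
      by (intro holomorphic_intros holomorphic_on_subset[OF hol] holomorphic_on_subset[OF hol']) auto
    then show ?thesis
      using sphere_val_holomorphic[OF op] z False nz[OF z]
      by (simp add: stereo_inverse_def inverse_eq_divide)
  qed
qed

lemma schwarzian_family_log_deriv_subsequence:
  assumes k: "k \<ge> 1" and f: "\<And>n. f n \<in> \<H> k M"
  obtains r :: "nat \<Rightarrow> nat" and \<gamma> where "strict_mono r"
    "spherically_loc_unif_converges (\<lambda>n z. deriv (f (r n)) z / f (r n) z) \<gamma> \<bbbD>"
    "\<exists>z\<in>\<bbbD>. \<gamma> z \<noteq> sphere_infinity"
proof -
  obtain r G g p a b c where r: "strict_mono r" and G: "G holomorphic_on \<bbbD>" "\<forall>z\<in>\<bbbD>. deriv G z \<noteq> 0"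
    and b: "\<forall>n. b n \<noteq> 0 \<and> c n = b n * a n"
    and feq: "\<forall>n z. f (r n) z = b n * (a n + g n z)" "\<forall>n z. deriv (f (r n)) z = b n * p n z"
    and g: "\<forall>K. compact K \<longrightarrow> K \<subseteq> \<bbbD> \<longrightarrow> uniform_limit K g G sequentially"
    and p: "\<forall>K. compact K \<longrightarrow> K \<subseteq> \<bbbD> \<longrightarrow> uniform_limit K p (deriv G) sequentially"
    and a: "convergent a \<or> filterlim a at_infinity sequentially"
    using schwarzian_family_subsequence[where f = f, OF k f] .
  have contG: "continuous_on K G" "continuous_on K (deriv G)" if "K \<subseteq> \<bbbD>" for K
    using G(1) that holomorphic_deriv[OF G(1)]
    by (auto intro!: holomorphic_on_imp_continuous_on intro: holomorphic_on_subset)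
  \<comment> \<open>The factor b_n cancels in f/f', so the behaviour of a_n alone decides the
    limit.\<close>
  have val: "sphere_val (\<lambda>z. deriv (f (r n)) z / f (r n) z) z = stereo_inverse ((a n + g n z) / p n z)"
    if "z \<in> \<bbbD>" for n z
    using sphere_val_log_deriv[OF k f that, of "r n"] b feq by simp
  have quot: "uniform_limit K (\<lambda>n z. u n z / p n z) (\<lambda>z. v z / deriv G z) sequentially"
    if K: "compact K" "K \<subseteq> \<bbbD>" and u: "uniform_limit K u v sequentially" "continuous_on K v" for K u v
  proof -
    have "\<forall>z\<in>K. deriv G z \<noteq> 0" using G(2) K by blast
    from uniform_limit_bounded_below[OF p[rule_format, OF K] K(1) contG(2)[OF K(2)] this]
    obtain \<delta> where "\<delta> > 0" "\<forall>z\<in>K. \<delta> \<le> cmod (deriv G z)" by metis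
    moreover have "bounded (v ` K)" using K u by (intro compact_imp_bounded compact_continuous_image)
    ultimately show ?thesis using u(1) p K by (intro uniform_lim_divide) auto
  qed
  from a show ?thesis
  proof
    assume "convergent a"
    then obtain a0 where a0: "a \<longlonglongrightarrow> a0" by (auto simp: convergent_def)
    show ?thesis
    proof (rule that[OF r spherically_loc_unif_convergesI])
      fix K :: "complex set" assume K: "compact K" "K \<subseteq> \<bbbD>"
      have "uniform_limit K (\<lambda>n z. a n + 1 * g n z) (\<lambda>z. a0 + 1 * G z) sequentially"
        by (intro uniform_limit_affine a0 tendsto_const g[rule_format] K contG)
      then have "uniform_limit K (\<lambda>n z. (a n + g n z) / p n z) (\<lambda>z. (a0 + G z) / deriv G z) sequentially"
        using quot[OF K, of "\<lambda>n z. a n + g n z" "\<lambda>z. a0 + G z"] contG(1)[OF K(2)]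
        by (simp add: continuous_on_add)
      from uniform_limit_stereo_inverse[OF this]
      show "uniform_limit K (\<lambda>n. sphere_val (\<lambda>z. deriv (f (r n)) z / f (r n) z))
          (\<lambda>z. stereo_inverse ((a0 + G z) / deriv G z)) sequentially"
        by (rule uniform_limit_cong'[THEN iffD1, rotated -1]) (use K val in auto)
    next
      \<comment> \<open>A limit equal to infinity everywhere would mean a0 + G vanishes identically,
        contrary to G'(0) \<noteq> 0.\<close>
      show "\<exists>z\<in>\<bbbD>. stereo_inverse ((a0 + G z) / deriv G z) \<noteq> sphere_infinity"
      proof (rule ccontr)
        assume "\<not> ?thesis"
        then have "G z = - a0" if "z \<in> \<bbbD>" for z
          using stereo_inverse_neq_infinity[of "(a0 + G z) / deriv G z"] that G(2)
          by (auto simp: add_eq_0_iff)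
        then have "eventually (\<lambda>z. G z = - a0) (nhds 0)"
          by (intro eventually_nhds[THEN iffD2] exI[of _ "\<bbbD>"]) auto
        then have "deriv G 0 = deriv (\<lambda>_. - a0) 0" by (intro deriv_cong_ev refl)
        then show False using G(2) by simp
      qed
    qed simp
  next
    assume inf: "filterlim a at_infinity sequentially"
    then have a1: "(\<lambda>n. 1 / a n) \<longlonglongrightarrow> 0" by (intro tendsto_divide_0[OF tendsto_const])
    have anz: "eventually (\<lambda>n. a n \<noteq> 0) sequentially"
      using filterlim_at_infinity_imp_eventually_ne[OF inf] .
    show ?thesis
    proof (rule that[OF r spherically_loc_unif_convergesI])
      fix K :: "complex set" assume K: "compact K" "K \<subseteq> \<bbbD>"
      \<comment> \<open>Taking a_n out of f/f' leaves a factor with the zero-free limit 1/G'. Hence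
        f/f' tends to infinity and f'/f to 0.\<close>
      have "uniform_limit K (\<lambda>n z. 1 + 1 / a n * g n z) (\<lambda>z. 1 + 0 * G z) sequentially"
        by (intro uniform_limit_affine a1 tendsto_const g[rule_format] K contG)
      then have "uniform_limit K (\<lambda>n z. (1 + 1 / a n * g n z) / p n z) (\<lambda>z. 1 / deriv G z) sequentially"
        using quot[OF K, of "\<lambda>n z. 1 + 1 / a n * g n z" "\<lambda>z. 1"] by simp
      moreover have "continuous_on K (\<lambda>z. 1 / deriv G z)"
        using contG(2)[OF K(2)] G(2) K by (intro continuous_intros) auto
      ultimately have lim: "uniform_limit K (\<lambda>n z. stereo (a n * ((1 + 1 / a n * g n z) / p n z)))
          (\<lambda>_. sphere_infinity) sequentially"
        using G(2) K by (intro uniform_limit_stereo_infinity[OF inf]) auto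
      show "uniform_limit K (\<lambda>n. sphere_val (\<lambda>z. deriv (f (r n)) z / f (r n) z))
          (\<lambda>z. stereo 0) sequentially"
      proof (rule uniform_limitI)
        fix e :: real assume e: "e > 0"
        from uniform_limitD[OF lim e] anz
        show "\<forall>\<^sub>F n in sequentially. \<forall>z\<in>K. dist (sphere_val (\<lambda>z. deriv (f (r n)) z / f (r n) z) z) (stereo 0) < e"
        proof eventually_elim
          case (elim n)
          have "a n * (1 + 1 / a n * g n z) = a n + g n z" for z
            using elim(2) by (simp add: distrib_left)
          then have eq: "a n * ((1 + 1 / a n * g n z) / p n z) = (a n + g n z) / p n z" for z
            by (simp only: times_divide_eq_right)
          show ?case
          proof
            fix z assume z: "z \<in> K"
            then have "dist (stereo ((a n + g n z) / p n z)) sphere_infinity < e"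
              using elim(1) unfolding eq by blast
            then show "dist (sphere_val (\<lambda>z. deriv (f (r n)) z / f (r n) z) z) (stereo 0) < e"
              using val[of z n] z K by (auto simp: dist_stereo_inverse_stereo_0)
          qed
        qed
      qed
    next
      show "\<exists>z\<in>\<bbbD>. stereo 0 \<noteq> sphere_infinity"
        using stereo_neq_infinity by (intro bexI[of _ 0]) auto
    qed simp
  qed
qed

lemma spherically_loc_unif_converges_pointwise:
  assumes "spherically_loc_unif_converges F g A" "z \<in> A"
  shows "(\<lambda>n. sphere_val (F n) z) \<longlonglongrightarrow> g z"
proof -
  obtain U where U: "z \<in> U" "uniform_limit (U \<inter> A) (\<lambda>n. sphere_val (F n)) g sequentially"
    using assms unfolding spherically_loc_unif_converges_def by blast
  then show ?thesis using assms(2) by (intro tendsto_uniform_limitI[OF U(2)]) auto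
qed

lemma schwarzian_family_log_deriv_normal:
  assumes k: "k \<ge> 1"
  shows "normal_family_on {\<lambda>z. deriv f z / f z | f. f \<in> \<H> k M} \<bbbD>"
  unfolding normal_family_on_def
proof (intro allI impI)
  fix F :: "nat \<Rightarrow> complex \<Rightarrow> complex" assume "\<forall>n. F n \<in> {\<lambda>z. deriv f z / f z | f. f \<in> \<H> k M}"
  then have "\<forall>n. \<exists>f. f \<in> \<H> k M \<and> F n = (\<lambda>z. deriv f z / f z)" by blast
  from choice[OF this] obtain f where f: "\<forall>n. f n \<in> \<H> k M \<and> F n = (\<lambda>z. deriv (f n) z / f n z)" by blast
  then have fH: "f n \<in> \<H> k M" for n by blast
  obtain r \<gamma> where r: "strict_mono r"
    and lim: "spherically_loc_unif_converges (\<lambda>n z. deriv (f (r n)) z / f (r n) z) \<gamma> \<bbbD>"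
    and "\<exists>z\<in>\<bbbD>. \<gamma> z \<noteq> sphere_infinity"
    using schwarzian_family_log_deriv_subsequence[where f = f, OF k fH] .
  note r lim
  moreover have "F \<circ> r = (\<lambda>n z. deriv (f (r n)) z / f (r n) z)" using f by (auto simp: fun_eq_iff)
  ultimately show "\<exists>r g. strict_mono r \<and> spherically_loc_unif_converges (F \<circ> r) g \<bbbD>"
    by (intro exI[of _ r] exI[of _ \<gamma>]) simp
qed

text \<open>Every sequence has a subsequence whose limit is finite at some point; a limit infinity
  of the full sequence would contradict uniqueness of limits there.\<close>

lemma schwarzian_family_log_deriv_not_infinity:
  assumes k: "k \<ge> 1" and F: "\<forall>n. F n \<in> {\<lambda>z. deriv f z / f z | f. f \<in> \<H> k M}"
    and inf: "spherically_loc_unif_converges F (\<lambda>_. sphere_infinity) \<bbbD>"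
  shows False
proof -
  have "\<forall>n. \<exists>f. f \<in> \<H> k M \<and> F n = (\<lambda>z. deriv f z / f z)" using F by blast
  from choice[OF this] obtain f where f: "\<forall>n. f n \<in> \<H> k M \<and> F n = (\<lambda>z. deriv (f n) z / f n z)" by blast
  then have fH: "f n \<in> \<H> k M" for n by blast
  obtain r \<gamma> where r: "strict_mono r"
    and lim: "spherically_loc_unif_converges (\<lambda>n z. deriv (f (r n)) z / f (r n) z) \<gamma> \<bbbD>"
    and "\<exists>z\<in>\<bbbD>. \<gamma> z \<noteq> sphere_infinity"
    using schwarzian_family_log_deriv_subsequence[where f = f, OF k fH] .
  then obtain z where z: "z \<in> \<bbbD>" "\<gamma> z \<noteq> sphere_infinity" by blast
  have "(\<lambda>n. sphere_val (F (r n)) z) \<longlonglongrightarrow> \<gamma> z"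
    using spherically_loc_unif_converges_pointwise[OF lim z(1)] f by simp
  moreover have "(\<lambda>n. sphere_val (F (r n)) z) \<longlonglongrightarrow> sphere_infinity"
    using LIMSEQ_subseq_LIMSEQ[OF spherically_loc_unif_converges_pointwise[OF inf z(1)] r] by (simp add: o_def)
  ultimately show False using LIMSEQ_unique z(2) by blast
qed

section \<open>The derivatives f'\<close>

lemma schwarzian_family_deriv_normal:
  assumes k: "k \<ge> 1"
  shows "normal_family_on {deriv f | f. f \<in> \<H> k M} \<bbbD>"
  unfolding normal_family_on_def
proof (intro allI impI)
  fix F :: "nat \<Rightarrow> complex \<Rightarrow> complex" assume "\<forall>n. F n \<in> {deriv f | f. f \<in> \<H> k M}"
  then have "\<forall>n. \<exists>f. f \<in> \<H> k M \<and> F n = deriv f" by blast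
  from choice[OF this] obtain f where f: "\<forall>n. f n \<in> \<H> k M \<and> F n = deriv (f n)" by blast
  then have fH: "f n \<in> \<H> k M" for n by blast
  obtain r G g p a b c where r: "strict_mono r" and G: "G holomorphic_on \<bbbD>" "\<forall>z\<in>\<bbbD>. deriv G z \<noteq> 0"
    and feq: "\<forall>n z. deriv (f (r n)) z = b n * p n z"
    and p: "\<forall>K. compact K \<longrightarrow> K \<subseteq> \<bbbD> \<longrightarrow> uniform_limit K p (deriv G) sequentially"
    and b: "convergent b \<or> filterlim b at_infinity sequentially"
    using schwarzian_family_subsequence[where f = f, OF k fH] .
  have contG: "continuous_on K (deriv G)" if "K \<subseteq> \<bbbD>" for K
    using that holomorphic_deriv[OF G(1)]
    by (auto intro!: holomorphic_on_imp_continuous_on intro: holomorphic_on_subset)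
  have val: "sphere_val ((F \<circ> r) n) z = stereo (b n * p n z)" if "z \<in> \<bbbD>" for n z
  proof -
    have "deriv (f (r n)) holomorphic_on \<bbbD>"
      using fH[of "r n"] by (auto simp: schwarzian_family_def intro: holomorphic_deriv)
    then show ?thesis using sphere_val_holomorphic[OF open_ball _ that] f feq by simp
  qed
  \<comment> \<open>Here f' = b_n p_n tends to b0 G' or to infinity. In the second case there are no
    exceptional points because G' is zero-free.\<close>
  from b have "\<exists>\<gamma>. \<forall>K. compact K \<longrightarrow> K \<subseteq> \<bbbD> \<longrightarrow> uniform_limit K (\<lambda>n z. stereo (b n * p n z)) \<gamma> sequentially"
  proof
    assume "convergent b"
    then obtain b0 where b0: "b \<longlonglongrightarrow> b0" by (auto simp: convergent_def)
    show ?thesis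
    proof (intro exI[of _ "\<lambda>z. stereo (0 + b0 * deriv G z)"] allI impI)
      fix K :: "complex set" assume K: "compact K" "K \<subseteq> \<bbbD>"
      have "uniform_limit K (\<lambda>n z. 0 + b n * p n z) (\<lambda>z. 0 + b0 * deriv G z) sequentially"
        by (intro uniform_limit_affine b0 tendsto_const p[rule_format] K contG)
      from uniform_limit_stereo[OF this]
      show "uniform_limit K (\<lambda>n z. stereo (b n * p n z)) (\<lambda>z. stereo (0 + b0 * deriv G z)) sequentially"
        by simp
    qed
  next
    assume inf: "filterlim b at_infinity sequentially"
    show ?thesis
    proof (intro exI[of _ "\<lambda>z. sphere_infinity"] allI impI)
      fix K :: "complex set" assume K: "compact K" "K \<subseteq> \<bbbD>"
      show "uniform_limit K (\<lambda>n z. stereo (b n * p n z)) (\<lambda>z. sphere_infinity) sequentially"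
        using G(2) K by (intro uniform_limit_stereo_infinity[OF inf p[rule_format]] contG) auto
    qed
  qed
  then obtain \<gamma> where \<gamma>: "\<And>K. compact K \<Longrightarrow> K \<subseteq> \<bbbD> \<Longrightarrow> uniform_limit K (\<lambda>n z. stereo (b n * p n z)) \<gamma> sequentially"
    by blast
  have "spherically_loc_unif_converges (F \<circ> r) \<gamma> \<bbbD>"
  proof (rule spherically_loc_unif_convergesI)
    fix K :: "complex set" assume K: "compact K" "K \<subseteq> \<bbbD>"
    show "uniform_limit K (\<lambda>n. sphere_val ((F \<circ> r) n)) \<gamma> sequentially"
      using \<gamma>[OF K] by (rule uniform_limit_cong'[THEN iffD1, rotated -1]) (use K val in auto)
  qed simp
  with r show "\<exists>r g. strict_mono r \<and> spherically_loc_unif_converges (F \<circ> r) g \<bbbD>" by blast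
qed

section \<open>Quasi-normality of the family itself\<close>

lemma schwarzian_family_quasi_normal:
  assumes k: "k \<ge> 1"
  shows "quasi_normal_family_on (\<H> k M) \<bbbD>"
  unfolding quasi_normal_family_on_def
proof (intro allI impI)
  fix f :: "nat \<Rightarrow> complex \<Rightarrow> complex" assume "\<forall>n. f n \<in> \<H> k M"
  then have fH: "f n \<in> \<H> k M" for n by blast
  obtain r G g p a b c where r: "strict_mono r" and G: "G holomorphic_on \<bbbD>" "\<forall>z\<in>\<bbbD>. deriv G z \<noteq> 0"
    and bc: "\<forall>n. b n \<noteq> 0 \<and> c n = b n * a n"
    and feq: "\<forall>n z. f (r n) z = b n * (a n + g n z)"
    and "\<forall>n z. deriv (f (r n)) z = b n * p n z"
    and g: "\<forall>K. compact K \<longrightarrow> K \<subseteq> \<bbbD> \<longrightarrow> uniform_limit K g G sequentially"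
    and "\<forall>K. compact K \<longrightarrow> K \<subseteq> \<bbbD> \<longrightarrow> uniform_limit K p (deriv G) sequentially"
    and a: "convergent a \<or> filterlim a at_infinity sequentially"
    and b: "convergent b \<or> filterlim b at_infinity sequentially"
    and c: "convergent c \<or> filterlim c at_infinity sequentially"
    using schwarzian_family_subsequence[where f = f, OF k fH] .
  have contG: "continuous_on K G" if "K \<subseteq> \<bbbD>" for K
    using that G(1) by (auto intro!: holomorphic_on_imp_continuous_on intro: holomorphic_on_subset)
  have val: "sphere_val ((f \<circ> r) n) z = stereo (f (r n) z)" if "z \<in> \<bbbD>" for n z
    using sphere_val_holomorphic[OF open_ball _ that] fH[of "r n"] by (simp add: schwarzian_family_def)
  define good where "good = (\<lambda>E \<gamma>. \<forall>K. compact K \<longrightarrow> K \<subseteq> \<bbbD> - E \<longrightarrow>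
      uniform_limit K (\<lambda>n z. stereo (f (r n) z)) \<gamma> sequentially)"
  \<comment> \<open>In f = c_n (1 + g_n/a_n) the second factor tends to 1, so c_n forces infinity on
    the whole disk. This covers convergent b_n with c_n \<rightarrow> \<infinity>, and also a_n and
    b_n both tending to infinity.\<close>
  have c_inf: "good {} (\<lambda>_. sphere_infinity)"
    if inf: "filterlim c at_infinity sequentially" and lim: "(\<lambda>n. 1 / a n) \<longlonglongrightarrow> 0"
    unfolding good_def
  proof (intro allI impI)
    fix K :: "complex set" assume K: "compact K" "K \<subseteq> \<bbbD> - {}"
    have "uniform_limit K (\<lambda>n z. 1 + 1 / a n * g n z) (\<lambda>z. 1 + 0 * G z) sequentially"
      by (intro uniform_limit_affine lim tendsto_const g[rule_format] contG) (use K in auto)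
    then have "uniform_limit K (\<lambda>n z. stereo (c n * (1 + 1 / a n * g n z))) (\<lambda>_. sphere_infinity) sequentially"
      using K by (intro uniform_limit_stereo_infinity[OF inf, where v = "\<lambda>z. 1 + 0 * G z"]) auto
    \<comment> \<open>The factorization fails when a_n = 0, since division by 0 gives 0; a nonzero
      c_n rules this out for large n.\<close>
    moreover have "eventually (\<lambda>n. \<forall>z\<in>K. stereo (c n * (1 + 1 / a n * g n z)) = stereo (f (r n) z)) sequentially"
      using filterlim_at_infinity_imp_eventually_ne[OF inf, of 0]
    proof eventually_elim
      case (elim n)
      then have "a n \<noteq> 0" using bc by auto
      then have "c n * (1 + 1 / a n * g n z) = f (r n) z" for z
        using bc feq by (simp add: field_simps)
      then show ?case by simp
    qed
    ultimately show "uniform_limit K (\<lambda>n z. stereo (f (r n) z)) (\<lambda>_. sphere_infinity) sequentially"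
      by (subst (asm) uniform_limit_cong) auto
  qed
  \<comment> \<open>Openness of the complement is recorded for the passage from compact sets to
    neighbourhoods in \<open>spherically_loc_unif_convergesI\<close>.\<close>
  have "\<exists>E \<gamma>. E \<subseteq> \<bbbD> \<and> (\<forall>z\<in>\<bbbD>. \<not> z islimpt E) \<and> open (\<bbbD> - E) \<and> good E \<gamma>"
    using b
  proof
    assume "convergent b"
    then obtain b0 where b0: "b \<longlonglongrightarrow> b0" by (auto simp: convergent_def)
    from c have "\<exists>\<gamma>. good {} \<gamma>"
    proof
      assume "convergent c"
      then obtain c0 where c0: "c \<longlonglongrightarrow> c0" by (auto simp: convergent_def)
      have "good {} (\<lambda>z. stereo (c0 + b0 * G z))"
        unfolding good_def
      proof (intro allI impI)
        fix K :: "complex set" assume K: "compact K" "K \<subseteq> \<bbbD> - {}"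
        have "uniform_limit K (\<lambda>n z. c n + b n * g n z) (\<lambda>z. c0 + b0 * G z) sequentially"
          by (intro uniform_limit_affine c0 b0 g[rule_format] contG) (use K in auto)
        from uniform_limit_stereo[OF this]
        show "uniform_limit K (\<lambda>n z. stereo (f (r n) z)) (\<lambda>z. stereo (c0 + b0 * G z)) sequentially"
          using bc feq by (simp add: distrib_left)
      qed
      then show ?thesis by blast
    next
      assume inf: "filterlim c at_infinity sequentially"
      \<comment> \<open>As c_n = b_n a_n with b_n \<noteq> 0, this quotient is 1/a_n.\<close>
      have "(\<lambda>n. b n / c n) \<longlonglongrightarrow> 0" by (rule tendsto_divide_0[OF b0 inf])
      then have "(\<lambda>n. 1 / a n) \<longlonglongrightarrow> 0" using bc by simp
      from c_inf[OF inf this] show ?thesis by blast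
    qed
    then show ?thesis by (intro exI[of _ "{}"]) auto
  next
    assume b_inf: "filterlim b at_infinity sequentially"
    from a show ?thesis
    proof
      assume "convergent a"
      then obtain a0 where a0: "a \<longlonglongrightarrow> a0" by (auto simp: convergent_def)
      \<comment> \<open>At these points a_n + g_n tends to 0, so b_n \<rightarrow> \<infinity> no
        longer forces f_n = b_n (a_n + g_n) to infinity.\<close>
      define E where "E = {z \<in> \<bbbD>. a0 + G z = 0}"
      have holE: "(\<lambda>z. a0 + G z) holomorphic_on \<bbbD>" by (intro holomorphic_intros G)
      have "\<not> z islimpt E" if z: "z \<in> \<bbbD>" for z
      proof
        assume lp: "z islimpt E"
        \<comment> \<open>An accumulation point of zeros inside the disk would make a0 + G vanish
          identically, again contrary to G'(0) \<noteq> 0.\<close>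
        have "a0 + G w = 0" if "w \<in> \<bbbD>" for w
          by (rule analytic_continuation[OF holE open_ball connected_ball _ z lp _ that]) (auto simp: E_def)
        then have "eventually (\<lambda>z. G z = - a0) (nhds 0)"
          by (intro eventually_nhds[THEN iffD2] exI[of _ "\<bbbD>"]) (auto simp: add_eq_0_iff)
        then have "deriv G 0 = deriv (\<lambda>_. - a0) 0" by (intro deriv_cong_ev refl)
        then show False using G(2) by simp
      qed
      moreover have "open (\<bbbD> - E)"
      proof -
        have "\<bbbD> - E = \<bbbD> \<inter> (\<lambda>z. a0 + G z) -` (- {0})" by (auto simp: E_def)
        then show ?thesis
          using continuous_open_preimage[OF holomorphic_on_imp_continuous_on[OF holE], of "- {0}"] by auto
      qed
      moreover have "good E (\<lambda>_. sphere_infinity)"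
        unfolding good_def
      proof (intro allI impI)
        fix K :: "complex set" assume K: "compact K" "K \<subseteq> \<bbbD> - E"
        have "uniform_limit K (\<lambda>n z. a n + 1 * g n z) (\<lambda>z. a0 + 1 * G z) sequentially"
          by (intro uniform_limit_affine a0 tendsto_const g[rule_format] contG) (use K in auto)
        moreover have "continuous_on K (\<lambda>z. a0 + 1 * G z)"
          using K by (intro continuous_intros contG) auto
        moreover have "a0 + 1 * G z \<noteq> 0" if "z \<in> K" for z using that K by (auto simp: E_def)
        ultimately have "uniform_limit K (\<lambda>n z. stereo (b n * (a n + 1 * g n z))) (\<lambda>_. sphere_infinity) sequentially"
          using K(1) by (intro uniform_limit_stereo_infinity[OF b_inf])
        then show "uniform_limit K (\<lambda>n z. stereo (f (r n) z)) (\<lambda>_. sphere_infinity) sequentially"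
          using feq by simp
      qed
      moreover have "E \<subseteq> \<bbbD>" by (auto simp: E_def)
      ultimately show ?thesis by blast
    next
      assume a_inf: "filterlim a at_infinity sequentially"
      have "filterlim (\<lambda>n. cmod (b n) * cmod (a n)) at_top sequentially"
        using a_inf b_inf by (intro filterlim_at_top_mult_at_top filterlim_at_infinity_imp_norm_at_top)
      then have "filterlim c at_infinity sequentially"
        using bc by (intro filterlim_norm_at_top_imp_at_infinity) (simp add: norm_mult)
      moreover have "(\<lambda>n. 1 / a n) \<longlonglongrightarrow> 0" by (rule tendsto_divide_0[OF tendsto_const a_inf])
      ultimately have "good {} (\<lambda>_. sphere_infinity)" by (rule c_inf)
      then show ?thesis by (intro exI[of _ "{}"]) auto
    qed
  qed
  then obtain E \<gamma> where E: "E \<subseteq> \<bbbD>" "\<forall>z\<in>\<bbbD>. \<not> z islimpt E" "open (\<bbbD> - E)" "good E \<gamma>" by blast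
  have "spherically_loc_unif_converges (f \<circ> r) \<gamma> (\<bbbD> - E)"
  proof (rule spherically_loc_unif_convergesI[OF E(3)])
    fix K assume K: "compact K" "K \<subseteq> \<bbbD> - E"
    then have "uniform_limit K (\<lambda>n z. stereo (f (r n) z)) \<gamma> sequentially" using E(4) by (simp add: good_def)
    then show "uniform_limit K (\<lambda>n. sphere_val ((f \<circ> r) n)) \<gamma> sequentially"
      by (rule uniform_limit_cong'[THEN iffD1, rotated -1]) (use K val in auto)
  qed
  with r E show "\<exists>r E g. strict_mono r \<and> E \<subseteq> \<bbbD> \<and> (\<forall>z\<in>\<bbbD>. \<not> z islimpt E) \<and>
      spherically_loc_unif_converges (f \<circ> r) g (\<bbbD> - E)" by blast
qed

theorem theorem1p1:
  fixes k :: nat and M :: real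
  assumes "k \<ge> 1"
  shows
    "loc_unif_bounded_on {\<lambda>z. deriv (deriv f) z / deriv f z | f. f \<in> \<H> k M} \<bbbD>
     \<and> (normal_family_on {\<lambda>z. deriv f z / f z | f. f \<in> \<H> k M} \<bbbD>
        \<and> \<not> (\<exists>F. (\<forall>n. F n \<in> {\<lambda>z. deriv f z / f z | f. f \<in> \<H> k M})
               \<and> spherically_loc_unif_converges F (\<lambda>_. sphere_infinity) \<bbbD>))
     \<and> normal_family_on {deriv f | f. f \<in> \<H> k M} \<bbbD>
     \<and> quasi_normal_family_on (\<H> k M) \<bbbD>"
  using schwarzian_family_pre_schwarzian_bounded[OF assms] schwarzian_family_log_deriv_normal[OF assms]
    schwarzian_family_log_deriv_not_infinity[OF assms] schwarzian_family_deriv_normal[OF assms]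
    schwarzian_family_quasi_normal[OF assms]
  by blast

end
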